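(* Let $d>0$ be a real number and let $a$ be a quantum multigraph. Then $t(a)\ge 0$ holds for every isolate indifferent, flatly reflection positive and $d$-bounded graph parameter $t$ if and only if for every $\epsilon>0$ there exist an integer $k\ge 0$ and some $\sigma\in\mathcal P_k(d)$ such that $a+\epsilon$ and $\sigma$ coincide up to labels and isolated vertices.
   Context: All graphs are finite, undirected and loopless, but may have multiple edges. A $k$-labeled graph is a graph in which $k$ different vertices are labeled $1,\dots,k$ (a $0$-labeled graph is an unlabeled graph). Let $\mathcal G_k$ be the set of isomorphism classes (respecting labels) of $k$-labeled graphs. The product of $F,G\in\mathcal G_k$ is obtained by taking the disjoint union and identifying vertices with the same label, keeping all edges with multiplicity. This makes $\mathcal G_k$ an abelian monoid whose identity is the graph with vertices $1,\dots,k$ and no edges (the empty graph if $k=0$). Let $\mathcal A_k$ be the monoid algebra of $\mathcal G_k$ over $\mathbb R$. A quantum multigraph is an element of $\mathcal A_0$, i.e. a finite formal real linear combination of unlabeled multigraphs. Let $\mathcal A_k^0\subseteq\mathcal A_k$ be the subalgebra spanned by the $k$-labeled graphs all of whose vertices are labeled; it is the polynomial algebra $\mathbb R[z_{ij}\mid 1\le i<j\le k]$, where $z_{ij}$ is the graph on the labeled vertices $1,\dots,k$ whose only edge is a single edge $ij$. For elements $r_1,\dots,r_m$ of a commutative ring $R$, the preorder generated by them is $\mathrm{PO}(r_1,\dots,r_m)=\{\sum_{e\in\{0,1\}^m}\sigma_e r_1^{e_1}\cdots r_m^{e_m}\mid \sigma_e \text{ a finite sum of squares in } R\}$. Set $\mathcal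 P_k(d)=\mathrm{PO}(d\pm z_{ij}\mid 1\le i<j\le k)\subseteq\mathcal A_k^0$ (generated by all $d+z_{ij}$ and $d-z_{ij}$). A graph parameter is a map $t:\mathcal G_0\to\mathbb R$; ignoring labels and extending linearly, it defines linear functionals $t:\mathcal A_k\to\mathbb R$ for all $k$. It is isolate indifferent if its value at a graph does not change when an isolated vertex is added; flatly reflection positive if $t(b^2)\ge 0$ for all $b\in\mathcal A_k^0$ and all $k$; $d$-bounded if $|t(K_2^k)|\le d^k$ for all $k\ge 0$, where $K_2^k$ is the graph with two vertices and $k$ edges between them. In $a+\epsilon$, the number $\epsilon$ stands for $\epsilon$ times the identity element of $\mathcal A_0$. Two elements of (possibly different) algebras $\mathcal A_k,\mathcal A_l$ coincide up to labels and isolated vertices if, after forgetting all labels (giving elements of $\mathcal A_0$), they become equal when each graph is identified with every graph obtained from it by adding or removing isolated vertices; i.e. they are equal modulo the linear span of all $G\sqcup K_1-G$, where $G$ ranges over unlabeled multigraphs (including the empty graph) and $K_1$ is the one-vertex graph. *)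

theory Defs
  imports Complex_Main "HOL-Library.Multiset" "HOL-Library.Poly_Mapping"
begin

section \<open>Labeled multigraphs up to isomorphism\<close>

text \<open>
  The algebras of \<open>k\<close>-labeled graphs are needed for all \<open>k\<close> at once, so all of them live in one
  type: multigraphs whose vertices may carry pairwise different labels from \<^typ>\<open>nat\<close>.  The vertex
  labeled \<open>i\<close> is represented by \<open>Lab i\<close> itself; the vertices \<open>Unl n\<close> are the unlabeled ones, and
  \<open>n\<close> is only a name.  An edge is the set of its two end vertices, and edges form a multiset.
\<close>

datatype vertex = Lab nat | Unl nat

type_synonym pregraph = "vertex set \<times> vertex set multiset"

definition wf_graph :: "pregraph \<Rightarrow> bool" where
  "wf_graph g \<longleftrightarrow> finite (fst g) \<and> (\<forall>e \<in># snd g. e \<subseteq> fst g \<and> card e = 2)"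

definition map_graph :: "(vertex \<Rightarrow> vertex) \<Rightarrow> pregraph \<Rightarrow> pregraph" where
  "map_graph f g = (f ` fst g, image_mset ((`) f) (snd g))"

definition graph_iso :: "pregraph \<Rightarrow> pregraph \<Rightarrow> bool" where
  "graph_iso g h \<longleftrightarrow> wf_graph g \<and> wf_graph h \<and>
     (\<exists>f. inj_on f (fst g) \<and> (\<forall>v \<in> fst g. \<forall>i. f v = Lab i \<longleftrightarrow> v = Lab i) \<and> h = map_graph f g)"

lemma graph_isoI:
  assumes "wf_graph g" "inj_on f (fst g)"
    "\<And>v i. v \<in> fst g \<Longrightarrow> f v = Lab i \<longleftrightarrow> v = Lab i" "h = map_graph f g"
  shows "graph_iso g h"
proof -
  have "card (f ` e) = 2" if "e \<in># snd g" for e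
    using that assms(1,2) unfolding wf_graph_def
    by (metis card_image inj_on_subset)
  then have "wf_graph h"
    using assms(1,4) by (auto simp: wf_graph_def map_graph_def)
  then show ?thesis
    using assms unfolding graph_iso_def by blast
qed

lemma map_graph_comp: "map_graph f (map_graph g x) = map_graph (f \<circ> g) x"
  by (simp add: map_graph_def image_comp multiset.map_comp comp_def image_image)

lemma map_graph_cong:
  assumes "wf_graph g" "\<And>v. v \<in> fst g \<Longrightarrow> f v = f' v"
  shows "map_graph f g = map_graph f' g"
  using assms unfolding map_graph_def wf_graph_def
  by (auto intro!: image_mset_cong image_cong)

lemma map_graph_id: "map_graph id g = g"
  by (simp add: map_graph_def)

lemma graph_iso_refl: "wf_graph g \<Longrightarrow> graph_iso g g"
  by (rule graph_isoI[where f = id]) (auto simp: map_graph_id)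

lemma graph_iso_sym:
  assumes "graph_iso g h" shows "graph_iso h g"
proof -
  obtain f where f: "wf_graph g" "wf_graph h" "inj_on f (fst g)"
    "\<And>v i. v \<in> fst g \<Longrightarrow> f v = Lab i \<longleftrightarrow> v = Lab i" "h = map_graph f g"
    using assms unfolding graph_iso_def by blast
  let ?f' = "inv_into (fst g) f"
  have h: "fst h = f ` fst g" by (simp add: f(5) map_graph_def)
  have "map_graph ?f' h = map_graph id g"
    unfolding f(5) map_graph_comp using f(1,3) by (intro map_graph_cong) auto
  moreover have "inj_on ?f' (fst h)" by (simp add: h inj_on_inv_into)
  moreover have "?f' v = Lab i \<longleftrightarrow> v = Lab i" if "v \<in> fst h" for v i
    using that h f(3,4) by auto
  ultimately show ?thesis
    using f(2) by (intro graph_isoI[where f = ?f']) (auto simp: map_graph_id)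
qed

lemma graph_iso_trans:
  assumes "graph_iso g h" "graph_iso h k" shows "graph_iso g k"
proof -
  obtain f where f: "wf_graph g" "inj_on f (fst g)"
    "\<And>v i. v \<in> fst g \<Longrightarrow> f v = Lab i \<longleftrightarrow> v = Lab i" "h = map_graph f g"
    using assms(1) unfolding graph_iso_def by blast
  obtain f' where f': "inj_on f' (fst h)"
    "\<And>v i. v \<in> fst h \<Longrightarrow> f' v = Lab i \<longleftrightarrow> v = Lab i" "k = map_graph f' h"
    using assms(2) unfolding graph_iso_def by blast
  have h: "fst h = f ` fst g" by (simp add: f(4) map_graph_def)
  show ?thesis
  proof (rule graph_isoI[where f = "f' \<circ> f"])
    show "inj_on (f' \<circ> f) (fst g)" using f(2) f'(1) h by (simp add: comp_inj_on)
    show "k = map_graph (f' \<circ> f) g" by (simp add: f(4) f'(3) map_graph_comp)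
  qed (use f f' h in auto)
qed

quotient_type lgraph = pregraph / partial: graph_iso
proof (rule part_equivpI)
  show "\<exists>x. graph_iso x x"
    by (rule exI[where x = "({}, {#})"], rule graph_iso_refl) (simp add: wf_graph_def)
  show "symp graph_iso" by (simp add: graph_iso_sym sympI)
  show "transp graph_iso" by (meson graph_iso_trans transpI)
qed

text \<open>
  The product of labeled graphs: equally labeled vertices are the same \<open>Lab i\<close> on both sides and
  hence get identified, while the unlabeled vertices are made disjoint.
\<close>

fun left_vertex :: "vertex \<Rightarrow> vertex" where
  "left_vertex (Lab i) = Lab i"
| "left_vertex (Unl n) = Unl (2 * n)"

fun right_vertex :: "vertex \<Rightarrow> vertex" where
  "right_vertex (Lab i) = Lab i"
| "right_vertex (Unl n) = Unl (2 * n + 1)"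

definition union_graph :: "pregraph \<Rightarrow> pregraph \<Rightarrow> pregraph" where
  "union_graph g h = (fst g \<union> fst h, snd g + snd h)"

definition glue :: "pregraph \<Rightarrow> pregraph \<Rightarrow> pregraph" where
  "glue g h = union_graph (map_graph left_vertex g) (map_graph right_vertex h)"

lemma inj_left: "inj left_vertex"
proof (rule injI)
  fix x y show "left_vertex x = left_vertex y \<Longrightarrow> x = y" by (cases x; cases y) auto
qed

lemma inj_right: "inj right_vertex"
proof (rule injI)
  fix x y show "right_vertex x = right_vertex y \<Longrightarrow> x = y" by (cases x; cases y) auto
qed

lemma left_eq_Lab [simp]: "left_vertex v = Lab i \<longleftrightarrow> v = Lab i" by (cases v) auto
lemma right_eq_Lab [simp]: "right_vertex v = Lab i \<longleftrightarrow> v = Lab i" by (cases v) auto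

lemma left_eq_right: "left_vertex v = right_vertex w \<longleftrightarrow> (\<exists>i. v = Lab i \<and> w = Lab i)"
  proof -
  have "2 * m \<noteq> Suc (2 * n)" for m n :: nat by presburger
  then show ?thesis by (cases v; cases w) auto
qed

lemma wf_union: "wf_graph g \<Longrightarrow> wf_graph h \<Longrightarrow> wf_graph (union_graph g h)"
  by (auto simp: wf_graph_def union_graph_def)

lemma wf_map: "wf_graph g \<Longrightarrow> inj f \<Longrightarrow> wf_graph (map_graph f g)"
  by (auto simp: wf_graph_def map_graph_def card_image inj_on_subset)

lemma wf_glue: "wf_graph g \<Longrightarrow> wf_graph h \<Longrightarrow> wf_graph (glue g h)"
  by (simp add: glue_def wf_union wf_map inj_left inj_right)

lemma map_union: "map_graph f (union_graph g h) = union_graph (map_graph f g) (map_graph f h)"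
  by (simp add: map_graph_def union_graph_def image_Un)

lemma map_glue:
  "map_graph f (glue g h) = union_graph (map_graph (f \<circ> left_vertex) g) (map_graph (f \<circ> right_vertex) h)"
  by (simp add: glue_def map_union map_graph_comp)

lemma fst_glue: "fst (glue g h) = left_vertex ` fst g \<union> right_vertex ` fst h"
  by (simp add: glue_def union_graph_def map_graph_def)

lemma glue_iso:
  assumes "graph_iso g g'" "graph_iso h h'" shows "graph_iso (glue g h) (glue g' h')"
proof -
  obtain f where f: "wf_graph g" "inj_on f (fst g)"
    "\<And>v i. v \<in> fst g \<Longrightarrow> f v = Lab i \<longleftrightarrow> v = Lab i" "g' = map_graph f g"
    using assms(1) unfolding graph_iso_def by blast
  obtain f' where f': "wf_graph h" "inj_on f' (fst h)"
    "\<And>v i. v \<in> fst h \<Longrightarrow> f' v = Lab i \<longleftrightarrow> v = Lab i" "h' = map_graph f' h"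
    using assms(2) unfolding graph_iso_def by blast
  define F where "F = (\<lambda>v. if \<exists>w \<in> fst g. v = left_vertex w
     then left_vertex (f (inv left_vertex v)) else right_vertex (f' (inv right_vertex v)))"
  have Fl: "F (left_vertex w) = left_vertex (f w)" if "w \<in> fst g" for w
    using that by (auto simp: F_def inv_f_f[OF inj_left])
  have Fr: "F (right_vertex w) = right_vertex (f' w)" if w: "w \<in> fst h" for w
  proof (cases "\<exists>v \<in> fst g. right_vertex w = left_vertex v")
    case True
    then obtain i where "w = Lab i" "w \<in> fst g" by (metis left_eq_right)
    then have "f w = Lab i" "f' w = Lab i" using f(3) f'(3) w by auto
    then show ?thesis using Fl[OF \<open>w \<in> fst g\<close>] \<open>w = Lab i\<close> by simp
  next
    case False
    then show ?thesis by (simp add: F_def inv_f_f[OF inj_right])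
  qed
  show ?thesis
  proof (rule graph_isoI[where f = F])
    show "wf_graph (glue g h)" by (simp add: f(1) f'(1) wf_glue)
    show "inj_on F (fst (glue g h))"
    proof (rule inj_onI)
      have lr: "left_vertex a = right_vertex b"
        if "F (left_vertex a) = F (right_vertex b)" "a \<in> fst g" "b \<in> fst h" for a b
        using that f(3) f'(3) by (metis Fl Fr left_eq_right)
      fix x y assume "x \<in> fst (glue g h)" "y \<in> fst (glue g h)" "F x = F y"
      then show "x = y"
        unfolding fst_glue
        using lr Fl Fr inj_onD[OF f(2)] inj_onD[OF f'(2)] injD[OF inj_left] injD[OF inj_right]
        by (elim UnE imageE) metis+
    qed
    show "F v = Lab i \<longleftrightarrow> v = Lab i" if "v \<in> fst (glue g h)" for v i
    proof -
      consider w where "w \<in> fst g" "v = left_vertex w" | w where "w \<in> fst h" "v = right_vertex w"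
        using \<open>v \<in> fst (glue g h)\<close> by (auto simp: fst_glue)
      then show ?thesis by cases (simp_all only: Fl Fr left_eq_Lab right_eq_Lab f(3) f'(3))
    qed
    show "glue g' h' = map_graph F (glue g h)"
      unfolding map_glue unfolding glue_def f(4) f'(4) map_graph_comp
      using f(1) f'(1) Fl Fr by (intro arg_cong2[of _ _ _ _ union_graph] map_graph_cong) auto
  qed
qed

text \<open>
  The library's monoid algebra \<^typ>\<open>'a \<Rightarrow>\<^sub>0 'b\<close> is based on additive monoids, hence the product
  of labeled graphs is written \<open>+\<close>, and the empty graph, its neutral element, is written \<open>0\<close>.
\<close>

instantiation lgraph :: comm_monoid_add
begin

lift_definition zero_lgraph :: lgraph is "({}, {#})"
  by (rule graph_iso_refl) (simp add: wf_graph_def)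

lift_definition plus_lgraph :: "lgraph \<Rightarrow> lgraph \<Rightarrow> lgraph" is glue
  by (rule glue_iso)

instance
proof
  fix a b c :: lgraph
  show "a + b + c = a + (b + c)"
  proof transfer
    fix a b c assume "graph_iso a a" "graph_iso b b" "graph_iso c c"
    then have wf: "wf_graph a" "wf_graph b" "wf_graph c" by (auto simp: graph_iso_def)
    define F where "F v = (case v of Lab i \<Rightarrow> Lab i | Unl n \<Rightarrow>
      if 4 dvd n then Unl (n div 2) else if even n then Unl (n - 1) else Unl (2 * n + 1))" for v
    have [simp]: "F (Lab i) = Lab i" "F (Unl (4 * n)) = Unl (2 * n)"
      "F (Unl (4 * n + 2)) = Unl (4 * n + 1)" "F (Unl (2 * n + 1)) = Unl (4 * n + 3)" for i n
    proof -
      have *: "\<not> 4 dvd 4 * n + 2" "\<not> 4 dvd 2 * n + 1" by presburger+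
      show "F (Lab i) = Lab i" "F (Unl (4 * n)) = Unl (2 * n)"
        "F (Unl (4 * n + 2)) = Unl (4 * n + 1)" "F (Unl (2 * n + 1)) = Unl (4 * n + 3)"
        using * by (auto simp: F_def)
    qed
    show "graph_iso (glue (glue a b) c) (glue a (glue b c))"
    proof (rule graph_isoI[where f = F])
      show "wf_graph (glue (glue a b) c)" using wf by (simp add: wf_glue)
      show "inj_on F (fst (glue (glue a b) c))"
      proof (rule inj_onI)
        fix x y assume "F x = F y"
        then show "x = y"
          by (cases x; cases y) (auto simp: F_def split: if_splits elim!: dvdE evenE; presburger)+
      qed
      show "F v = Lab i \<longleftrightarrow> v = Lab i" for v i by (cases v) (auto simp: F_def)
      have "F (left_vertex (left_vertex v)) = left_vertex v" for v
        by (cases v) (auto simp: mult.assoc[symmetric])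
      moreover have "F (left_vertex (right_vertex v)) = right_vertex (left_vertex v)" for v
      proof (cases v)
        case (Unl n)
        have "2 * (2 * n + 1) = 4 * n + 2" by simp
        then show ?thesis using Unl \<open>F (Unl (4 * n + 2)) = Unl (4 * n + 1)\<close>
          by (simp only: left_vertex.simps right_vertex.simps) simp
      qed simp
      moreover have "F (right_vertex v) = right_vertex (right_vertex v)" for v
      proof (cases v)
        case (Unl n)
        have "2 * (2 * n + 1) + 1 = 4 * n + 3" by simp
        then show ?thesis using Unl \<open>F (Unl (2 * n + 1)) = Unl (4 * n + 3)\<close>
          by (simp only: right_vertex.simps)
      qed simp
      ultimately show "glue a (glue b c) = map_graph F (glue (glue a b) c)"
        by (simp add: glue_def map_union map_graph_comp comp_def)
          (simp add: union_graph_def ac_simps)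
    qed
  qed
  show "a + b = b + a"
  proof transfer
    fix a b assume "graph_iso a a" "graph_iso b b"
    then have wf: "wf_graph a" "wf_graph b" by (auto simp: graph_iso_def)
    define F where "F v = (case v of Lab i \<Rightarrow> Lab i | Unl n \<Rightarrow>
      if even n then Unl (n + 1) else Unl (n - 1))" for v
    show "graph_iso (glue a b) (glue b a)"
    proof (rule graph_isoI[where f = F])
      show "wf_graph (glue a b)" using wf by (simp add: wf_glue)
      show "inj_on F (fst (glue a b))"
      proof (rule inj_onI)
        have "F (F v) = v" for v by (cases v) (auto simp: F_def)
        then show "x = y" if "F x = F y" for x y using that by metis
      qed
      show "F v = Lab i \<longleftrightarrow> v = Lab i" for v i by (cases v) (auto simp: F_def)
      have "F (left_vertex v) = right_vertex v" for v by (cases v) (auto simp: F_def)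
      moreover have "F (right_vertex v) = left_vertex v" for v by (cases v) (auto simp: F_def)
      ultimately show "glue b a = map_graph F (glue a b)"
        by (simp add: glue_def map_union map_graph_comp comp_def)
          (simp add: union_graph_def ac_simps)
    qed
  qed
  show "0 + a = a"
  proof transfer
    fix a assume "graph_iso a a"
    then have wf: "wf_graph a" by (auto simp: graph_iso_def)
    have "glue ({}, {#}) a = map_graph right_vertex a"
      by (simp add: glue_def union_graph_def map_graph_def)
    then have "graph_iso a (glue ({}, {#}) a)"
      using wf inj_right by (intro graph_isoI[where f = right_vertex]) (auto simp: inj_on_def)
    then show "graph_iso (glue ({}, {#}) a) a" by (rule graph_iso_sym)
  qed
qed

end

lift_definition labels :: "lgraph \<Rightarrow> nat set" is "\<lambda>g. {i. Lab i \<in> fst g}"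
proof -
  fix g h assume "graph_iso g h"
  then obtain f where "\<forall>v \<in> fst g. \<forall>i. f v = Lab i \<longleftrightarrow> v = Lab i" "h = map_graph f g"
    unfolding graph_iso_def by blast
  then show "{i. Lab i \<in> fst g} = {i. Lab i \<in> fst h}"
    by (auto simp: map_graph_def image_iff) metis+
qed

lift_definition all_labeled :: "lgraph \<Rightarrow> bool" is "\<lambda>g. fst g \<subseteq> range Lab"
proof -
  fix g h assume "graph_iso g h"
  then obtain f where "\<forall>v \<in> fst g. \<forall>i. f v = Lab i \<longleftrightarrow> v = Lab i" "h = map_graph f g"
    unfolding graph_iso_def by blast
  then show "(fst g \<subseteq> range Lab) = (fst h \<subseteq> range Lab)"
    by (auto simp: map_graph_def subset_iff image_iff)
qed

fun unlabel_vertex :: "vertex \<Rightarrow> vertex" where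
  "unlabel_vertex (Lab i) = Unl (2 * i)"
| "unlabel_vertex (Unl n) = Unl (2 * n + 1)"

lift_definition unlabel :: "lgraph \<Rightarrow> lgraph" is "map_graph unlabel_vertex"
proof -
  have inj: "inj unlabel_vertex"
  proof (rule injI)
    fix x y show "unlabel_vertex x = unlabel_vertex y \<Longrightarrow> x = y"
      by (cases x; cases y; simp) presburger+
  qed
  have nolab: "unlabel_vertex v \<noteq> Lab i" for v i by (cases v) auto
  fix g h assume "graph_iso g h"
  then obtain f where f: "wf_graph g" "inj_on f (fst g)" "h = map_graph f g"
    unfolding graph_iso_def by blast
  let ?F = "unlabel_vertex \<circ> f \<circ> inv unlabel_vertex"
  show "graph_iso (map_graph unlabel_vertex g) (map_graph unlabel_vertex h)"
  proof (rule graph_isoI[where f = ?F])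
    show "wf_graph (map_graph unlabel_vertex g)" using f(1) inj by (rule wf_map)
    show "inj_on ?F (fst (map_graph unlabel_vertex g))"
      using f(2) inj by (auto simp: map_graph_def inj_on_def)
    show "?F v = Lab i \<longleftrightarrow> v = Lab i" if "v \<in> fst (map_graph unlabel_vertex g)" for v i
      using that nolab by (auto simp: map_graph_def)
    show "map_graph unlabel_vertex h = map_graph ?F (map_graph unlabel_vertex g)"
      using inj by (simp add: f(3) map_graph_comp comp_def)
  qed
qed

definition graphs :: "nat \<Rightarrow> lgraph set" where
  "graphs k = {G. labels G = {1..k}}"

definition edgeless :: "nat \<Rightarrow> lgraph" where
  "edgeless k = abs_lgraph (Lab ` {1..k}, {#})"

text \<open>The following is only meaningful for different \<open>i, j \<in> {1..k}\<close>.\<close>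

definition edge_graph :: "nat \<Rightarrow> nat \<Rightarrow> nat \<Rightarrow> lgraph" where
  "edge_graph k i j = abs_lgraph (Lab ` {1..k}, {#{Lab i, Lab j}#})"

definition K1 :: lgraph where
  "K1 = abs_lgraph ({Unl 0}, {#})"

definition K2 :: "nat \<Rightarrow> lgraph" where
  "K2 m = abs_lgraph ({Unl 0, Unl 1}, replicate_mset m {Unl 0, Unl 1})"


section \<open>The algebras of quantum graphs\<close>

text \<open>
  \<open>quantum k\<close> is the monoid algebra of \<open>graphs k\<close>.  It is closed under the operations of the ambient
  commutative ring, but for \<open>k > 0\<close> it has its own identity \<open>scalar k 1\<close> (see below).
\<close>

type_synonym quantum_graph = "lgraph \<Rightarrow>\<^sub>0 real"

abbreviation single_graph :: "lgraph \<Rightarrow> real \<Rightarrow> quantum_graph" where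
  "single_graph \<equiv> Poly_Mapping.single"

definition quantum :: "nat \<Rightarrow> quantum_graph set" where
  "quantum k = {a. Poly_Mapping.keys a \<subseteq> graphs k}"

definition flat_quantum :: "nat \<Rightarrow> quantum_graph set" where
  "flat_quantum k = {a \<in> quantum k. \<forall>G \<in> Poly_Mapping.keys a. all_labeled G}"

definition scalar :: "nat \<Rightarrow> real \<Rightarrow> quantum_graph" where
  "scalar k c = single_graph (edgeless k) c"

definition zvar :: "nat \<Rightarrow> nat \<Rightarrow> nat \<Rightarrow> quantum_graph" where
  "zvar k i j = single_graph (edge_graph k i j) 1"

lemma labels_plus: "labels (F + G) = labels F \<union> labels G"
proof -
  have "Lab i \<in> left_vertex ` A \<longleftrightarrow> Lab i \<in> A" "Lab i \<in> right_vertex ` A \<longleftrightarrow> Lab i \<in> A" for i A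
  proof -
    show "Lab i \<in> left_vertex ` A \<longleftrightarrow> Lab i \<in> A"
      by (auto intro!: image_eqI[of _ _ "Lab i"]) (metis left_eq_Lab)
    show "Lab i \<in> right_vertex ` A \<longleftrightarrow> Lab i \<in> A"
      by (auto intro!: image_eqI[of _ _ "Lab i"]) (metis right_eq_Lab)
  qed
  then show ?thesis by transfer (auto simp: fst_glue)
qed

lemma all_labeled_plus: "all_labeled (F + G) \<longleftrightarrow> all_labeled F \<and> all_labeled G"
proof -
  have "left_vertex v \<in> range Lab \<longleftrightarrow> v \<in> range Lab"
    "right_vertex v \<in> range Lab \<longleftrightarrow> v \<in> range Lab" for v
    by (cases v; auto)+
  then show ?thesis by transfer (auto simp: fst_glue subset_iff)
qed

lemma edgeless_plus:
  assumes "G \<in> graphs k" shows "edgeless k + G = G"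
proof -
  have wf: "wf_graph (Lab ` {1..k}, {#})" by (simp add: wf_graph_def)
  obtain g where g: "wf_graph g" "G = abs_lgraph g"
    by (metis Quotient_lgraph Quotient_rep_reflp Quotient_abs_rep graph_iso_def)
  have gg: "graph_iso g g" using g(1) by (rule graph_iso_refl)
  have "{i. Lab i \<in> fst g} = {1..k}"
    using assms by (simp add: graphs_def g(2) labels.abs_eq[OF gg])
  then have L: "Lab ` {1..k} \<subseteq> fst g" by blast
  have "glue (Lab ` {1..k}, {#}) g = map_graph right_vertex g"
  proof -
    have "left_vertex ` Lab ` {1..k} = right_vertex ` Lab ` {1..k}" by (simp add: image_image)
    then have "left_vertex ` Lab ` {1..k} \<subseteq> right_vertex ` fst g" using L by blast
    then show ?thesis by (auto simp: glue_def union_graph_def map_graph_def)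
  qed
  then have "graph_iso g (glue (Lab ` {1..k}, {#}) g)"
    using g(1) inj_right by (intro graph_isoI[where f = right_vertex]) (auto simp: inj_on_def)
  then have "abs_lgraph (glue (Lab ` {1..k}, {#}) g) = abs_lgraph g"
    by (metis Quotient_lgraph Quotient_rel_abs graph_iso_sym)
  then show ?thesis
    by (simp only: edgeless_def g(2) plus_lgraph.abs_eq[OF graph_iso_refl[OF wf] gg])
qed

lemma quantum_times: "a \<in> quantum k \<Longrightarrow> b \<in> quantum k \<Longrightarrow> a * b \<in> quantum k"
  using keys_mult[of a b] by (fastforce simp: quantum_def graphs_def labels_plus)

lemma flat_quantum_times: "a \<in> flat_quantum k \<Longrightarrow> b \<in> flat_quantum k \<Longrightarrow> a * b \<in> flat_quantum k"
  using keys_mult[of a b] by (fastforce simp: flat_quantum_def quantum_times all_labeled_plus)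

lemma scalar_one_times:
  assumes "a \<in> quantum k" shows "scalar k 1 * a = a"
proof -
  have "a = (\<Sum>G \<in> Poly_Mapping.keys a. single_graph G (Poly_Mapping.lookup a G))"
    by (rule poly_mapping_eqI) (simp add: lookup_sum lookup_single when_def in_keys_iff)
  moreover have "scalar k 1 * single_graph G c = single_graph G c"
    if "G \<in> Poly_Mapping.keys a" for G c
    using that assms edgeless_plus by (auto simp: scalar_def mult_single quantum_def)
  ultimately show ?thesis
    by (metis (no_types, lifting) sum.cong sum_distrib_left)
qed

definition forget_labels :: "quantum_graph \<Rightarrow> quantum_graph" where
  "forget_labels a = (\<Sum>G \<in> Poly_Mapping.keys a. single_graph (unlabel G) (Poly_Mapping.lookup a G))"

lemma unlabel_graphs_0: "G \<in> graphs 0 \<Longrightarrow> unlabel G = G"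
  unfolding graphs_def
proof simp
  show "labels G = {} \<Longrightarrow> unlabel G = G"
  proof transfer
    fix g assume g: "graph_iso g g" "{i. Lab i \<in> fst g} = {}"
    have "inj unlabel_vertex"
    proof (rule injI)
      fix x y show "unlabel_vertex x = unlabel_vertex y \<Longrightarrow> x = y"
        by (cases x; cases y; simp) presburger+
    qed
    moreover have "unlabel_vertex v \<noteq> Lab i" for v i by (cases v) auto
    ultimately have "graph_iso g (map_graph unlabel_vertex g)"
    proof (intro graph_isoI[where f = unlabel_vertex])
      show "wf_graph g" using g(1) by (simp add: graph_iso_def)
      show "unlabel_vertex v = Lab i \<longleftrightarrow> v = Lab i" if "v \<in> fst g" for v i
        using that g(2) \<open>\<And>v i. unlabel_vertex v \<noteq> Lab i\<close> by blast
    qed (auto intro: inj_on_subset)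
    then show "graph_iso (map_graph unlabel_vertex g) g" by (rule graph_iso_sym)
  qed
qed

definition isolate_span :: "quantum_graph set" where
  "isolate_span = {\<Sum>G \<in> F. single_graph (G + K1) (c G) - single_graph G (c G) | F c.
     finite F \<and> F \<subseteq> graphs 0}"

definition coincide :: "quantum_graph \<Rightarrow> quantum_graph \<Rightarrow> bool" where
  "coincide a b \<longleftrightarrow> forget_labels a - forget_labels b \<in> isolate_span"


section \<open>Preorders\<close>

text \<open>
  \<open>S\<close> is a ring with the operations of the ambient ring, possibly with a different identity.  The
  empty product below is the identity of the ambient ring, but it only occurs multiplied by an
  element of \<open>S\<close>, on which it acts like the identity of \<open>S\<close>.
\<close>

definition sums_of_squares :: "'a::comm_ring_1 set \<Rightarrow> 'a set" where
  "sums_of_squares S = {\<Sum>x \<leftarrow> xs. x\<^sup>2 | xs. set xs \<subseteq> S}"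

definition preorder_generated :: "'a::comm_ring_1 set \<Rightarrow> 'i set \<Rightarrow> ('i \<Rightarrow> 'a) \<Rightarrow> 'a set" where
  "preorder_generated S I r =
     {\<Sum>e \<in> Pow I. \<sigma> e * (\<Prod>i \<in> e. r i) | \<sigma>. \<forall>e \<in> Pow I. \<sigma> e \<in> sums_of_squares S}"

definition bound_preorder :: "nat \<Rightarrow> real \<Rightarrow> quantum_graph set" where
  "bound_preorder k d = preorder_generated (flat_quantum k)
     ({(i, j). 1 \<le> i \<and> i < j \<and> j \<le> k} \<times> {True, False})
     (\<lambda>((i, j), plus). if plus then scalar k d + zvar k i j else scalar k d - zvar k i j)"


section \<open>Graph parameters\<close>

text \<open>
  A graph parameter is a function on \<open>graphs 0\<close>; its values elsewhere are irrelevant, as it is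
  only ever applied to unlabeled graphs.
\<close>

type_synonym graph_parameter = "lgraph \<Rightarrow> real"

definition extend :: "graph_parameter \<Rightarrow> quantum_graph \<Rightarrow> real" where
  "extend t a = (\<Sum>G \<in> Poly_Mapping.keys a. Poly_Mapping.lookup a G * t (unlabel G))"

definition isolate_indifferent :: "graph_parameter \<Rightarrow> bool" where
  "isolate_indifferent t \<longleftrightarrow> (\<forall>G \<in> graphs 0. t (G + K1) = t G)"

definition flatly_reflection_positive :: "graph_parameter \<Rightarrow> bool" where
  "flatly_reflection_positive t \<longleftrightarrow> (\<forall>k. \<forall>b \<in> flat_quantum k. extend t (b\<^sup>2) \<ge> 0)"

definition bounded_parameter :: "real \<Rightarrow> graph_parameter \<Rightarrow> bool" where
  "bounded_parameter d t \<longleftrightarrow> (\<forall>m. \<bar>t (K2 m)\<bar> \<le> d ^ m)"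

end

theory Submission
  imports Defs
begin

text \<open>
  Modulo isolated vertices, every unlabeled graph arises from a graph with all vertices labeled by
  forgetting labels.  So an isolate indifferent graph parameter is the same as a linear functional
  on polynomials in the edge variables \<open>z\<^sub>i\<^sub>j\<close> that is invariant under permuting the labels, flat
  reflection positivity is nonnegativity of this functional on squares, and the theorem becomes an
  Archimedean Positivstellensatz of a simple kind.

  Soundness of the certificates (\<open>positive_on_preorder\<close>).  Let \<open>L\<close> be nonnegative on squares, and let
  \<open>\<bar>L (z\<^sup>m)\<bar> \<le> d\<^sup>m\<close> for an edge variable \<open>z\<close> and all \<open>m\<close>.  For a weight \<open>q\<close> such that \<open>b \<mapsto> L (b\<^sup>2 q)\<close> is
  nonnegative, the moments \<open>s m = L (b\<^sup>2 q z\<^sup>m)\<close> satisfy \<open>(s n)\<^sup>2 \<le> s 0 * s (2 n)\<close> and grow at most like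
  \<open>d\<^sup>m\<close>.  Iterating the first inequality along powers of two gives \<open>\<bar>s 1\<bar> \<le> d * s 0\<close>, that is,
  nonnegativity of \<open>L (b\<^sup>2 q (d + z))\<close> and \<open>L (b\<^sup>2 q (d - z))\<close>.  So the factors of a product of
  generators can be added to the weight one after the other.

  Completeness of the certificates.  The elements that coincide with a member of some preorder form
  a convex cone (\<open>vector_cone_bound_cone\<close>), because a preorder on \<open>k\<close> labels embeds into the one on
  \<open>k + 1\<close> labels by adding an isolated vertex.  The identity is an order unit of this cone
  (\<open>one_order_unit\<close>), because by induction on the number of edges every monomial \<open>m\<close> with \<open>n\<close> edges
  satisfies \<open>d\<^sup>n \<plusminus> m \<in> \<P>\<^sub>k(d)\<close>.  If \<open>a + \<epsilon>\<close> is not in the cone, a linear functional separates it from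
  the cone (\<open>vector_cone_separation\<close>).  The functional does not see labels or isolated vertices, so
  it comes from a graph parameter; this parameter is flatly reflection positive as the cone contains
  the squares, it is \<open>d\<close>-bounded as the cone contains \<open>d\<^sup>n \<plusminus> m\<close>, and it is at most \<open>-\<epsilon>\<close> on \<open>a\<close>.
\<close>


section \<open>Separation from a cone with an order unit\<close>

definition vector_cone :: "'a::real_vector set \<Rightarrow> bool" where
  "vector_cone C \<longleftrightarrow> 0 \<in> C \<and> (\<forall>x\<in>C. \<forall>y\<in>C. x + y \<in> C) \<and> (\<forall>c\<ge>0. \<forall>x\<in>C. c *\<^sub>R x \<in> C)"

lemma vector_coneD:
  assumes "vector_cone C"
  shows "0 \<in> C" "\<And>x y. x \<in> C \<Longrightarrow> y \<in> C \<Longrightarrow> x + y \<in> C"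
    "\<And>c x. 0 \<le> c \<Longrightarrow> x \<in> C \<Longrightarrow> c *\<^sub>R x \<in> C"
  using assms by (auto simp: vector_cone_def)

lemma vector_cone_add_ray:
  assumes "vector_cone C"
  shows "vector_cone {x + c *\<^sub>R v | x c. x \<in> C \<and> 0 \<le> c}" (is "vector_cone ?D")
  unfolding vector_cone_def
proof (intro conjI ballI allI impI)
  have "0 = 0 + 0 *\<^sub>R v" by simp
  then show "0 \<in> ?D" using vector_coneD(1)[OF assms] by fastforce
next
  fix x y assume "x \<in> ?D" "y \<in> ?D"
  then obtain a b c d where "x = a + c *\<^sub>R v" "y = b + d *\<^sub>R v" "a \<in> C" "b \<in> C" "0 \<le> c" "0 \<le> d"
    by blast
  then have "x + y = (a + b) + (c + d) *\<^sub>R v" "a + b \<in> C" "0 \<le> c + d"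
    using vector_coneD(2)[OF assms] by (auto simp: algebra_simps)
  then show "x + y \<in> ?D" by blast
next
  fix r x assume "0 \<le> (r::real)" "x \<in> ?D"
  then obtain a c where "x = a + c *\<^sub>R v" "a \<in> C" "0 \<le> c" by blast
  then have "r *\<^sub>R x = r *\<^sub>R a + (r * c) *\<^sub>R v" "r *\<^sub>R a \<in> C" "0 \<le> r * c"
    using vector_coneD(3)[OF assms \<open>0 \<le> r\<close>] \<open>0 \<le> r\<close> by (auto simp: algebra_simps)
  then show "r *\<^sub>R x \<in> ?D" by blast
qed

lemma vector_cone_scale_pos_iff:
  assumes "vector_cone C" "0 < c"
  shows "c *\<^sub>R x \<in> C \<longleftrightarrow> x \<in> C"
proof
  assume "c *\<^sub>R x \<in> C"
  then have "inverse c *\<^sub>R (c *\<^sub>R x) \<in> C"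
    using assms vector_coneD(3)[OF assms(1), of "inverse c" "c *\<^sub>R x"] by simp
  then show "x \<in> C" using assms(2) by simp
qed (use assms in \<open>auto intro: vector_coneD(3)\<close>)

text \<open>
  A cone that is maximal among those avoiding \<open>- u\<close> is total: if neither \<open>x\<close> nor \<open>- x\<close> could be
  adjoined, \<open>- u\<close> would lie in both enlarged cones, and a positive combination of the two
  representations, in which \<open>x\<close> cancels, would put \<open>- u\<close> into the cone itself.
\<close>

lemma exists_total_vector_cone:
  fixes u :: "'a::real_vector"
  assumes C: "vector_cone C" and u: "- u \<notin> C"
  obtains M where "vector_cone M" "C \<subseteq> M" "- u \<notin> M" "\<And>x. x \<in> M \<or> - x \<in> M"
proof -
  define A where "A = {M. vector_cone M \<and> C \<subseteq> M \<and> - u \<notin> M}"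
  have "\<exists>M\<in>A. \<forall>X\<in>A. M \<subseteq> X \<longrightarrow> X = M"
  proof (rule subset_Zorn_nonempty)
    show "A \<noteq> {}" using C u by (auto simp: A_def)
    fix \<C> assume ne: "\<C> \<noteq> {}" and ch: "subset.chain A \<C>"
    have sub: "\<And>X. X \<in> \<C> \<Longrightarrow> vector_cone X \<and> C \<subseteq> X \<and> - u \<notin> X"
      using ch by (auto simp: subset_chain_def A_def)
    have "x + y \<in> \<Union>\<C>" if "x \<in> \<Union>\<C>" "y \<in> \<Union>\<C>" for x y
    proof -
      from that(1) obtain X where X: "X \<in> \<C>" "x \<in> X" by (rule UnionE)
      from that(2) obtain Y where Y: "Y \<in> \<C>" "y \<in> Y" by (rule UnionE)
      note XY = X(1) Y(1) X(2) Y(2)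
      then have "X \<subseteq> Y \<or> Y \<subseteq> X" using ch by (auto simp: subset_chain_def)
      then consider "x \<in> Y" | "y \<in> X" using XY(3,4) by blast
      then show ?thesis
      proof cases
        case 1
        then have "x + y \<in> Y" using XY(2,4) sub by (intro vector_coneD(2)) auto
        then show ?thesis using XY(2) by blast
      next
        case 2
        then have "x + y \<in> X" using XY(1,3) sub by (intro vector_coneD(2)) auto
        then show ?thesis using XY(1) by blast
      qed
    qed
    moreover have "0 \<in> \<Union>\<C>" using ne sub vector_coneD(1) by blast
    moreover have "c *\<^sub>R x \<in> \<Union>\<C>" if "0 \<le> c" "x \<in> \<Union>\<C>" for c x
    proof -
      from that(2) obtain X where X: "X \<in> \<C>" "x \<in> X" by (rule UnionE)
      then have "c *\<^sub>R x \<in> X" using sub that(1) by (intro vector_coneD(3)) auto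
      then show ?thesis using X(1) by blast
    qed
    ultimately have "vector_cone (\<Union>\<C>)" unfolding vector_cone_def by simp
    then show "\<Union>\<C> \<in> A" using ne sub by (auto simp: A_def)
  qed
  then obtain M where MA: "M \<in> A" and max': "\<forall>X\<in>A. M \<subseteq> X \<longrightarrow> X = M" by (rule bexE)
  have M: "vector_cone M" "C \<subseteq> M" "- u \<notin> M" using MA by (auto simp: A_def)
  have max: "X = M" if "vector_cone X" "C \<subseteq> X" "- u \<notin> X" "M \<subseteq> X" for X
    using that max' by (simp add: A_def)
  have key: "\<exists>m c. - u = m + c *\<^sub>R x \<and> m \<in> M \<and> 0 < c" if "x \<notin> M" for x
  proof -
    let ?D = "{y + c *\<^sub>R x | y c. y \<in> M \<and> 0 \<le> c}"
    have MD: "M \<subseteq> ?D"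
    proof
      fix y assume "y \<in> M"
      then show "y \<in> ?D" by (intro CollectI exI[of _ y] exI[of _ 0]) auto
    qed
    have "x = 0 + 1 *\<^sub>R x" by simp
    then have "x \<in> ?D" using vector_coneD(1)[OF M(1)] zero_le_one by blast
    then have "?D \<noteq> M" using that by blast
    then have "- u \<in> ?D" using max[OF vector_cone_add_ray[OF M(1)] _ _ MD] M(2) MD by blast
    then obtain m c where mc: "- u = m + c *\<^sub>R x" "m \<in> M" "0 \<le> c" by blast
    then have "c \<noteq> 0" using M(3) by auto
    with mc show ?thesis by force
  qed
  have "x \<in> M \<or> - x \<in> M" for x
  proof (rule ccontr)
    assume "\<not> ?thesis"
    then obtain m c n d where mc: "- u = m + c *\<^sub>R x" "m \<in> M" "0 < c"
      and nd: "- u = n + d *\<^sub>R (- x)" "n \<in> M" "0 < d"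
      using key[of x] key[of "- x"] by blast
    have "(c + d) *\<^sub>R (- u) = d *\<^sub>R (- u) + c *\<^sub>R (- u)"
      by (simp add: algebra_simps)
    also have "\<dots> = d *\<^sub>R (m + c *\<^sub>R x) + c *\<^sub>R (n + d *\<^sub>R (- x))"
      using mc(1) nd(1) by simp
    also have "\<dots> = d *\<^sub>R m + c *\<^sub>R n" by (simp add: algebra_simps)
    also have "\<dots> \<in> M" using M(1) mc nd by (intro vector_coneD) auto
    finally show False
      using M(3) vector_cone_scale_pos_iff[OF M(1), of "c + d" "- u"] mc(3) nd(3) by auto
  qed
  then show ?thesis using that M by blast
qed

text \<open>
  A total cone with order unit \<open>u\<close> determines its functional: \<open>x\<close> is sent to the cut in the real line
  between the \<open>r\<close> with \<open>r u - x\<close> in the cone and those with \<open>x - r u\<close> in the cone.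
\<close>

lemma total_vector_cone_functional:
  fixes u :: "'a::real_vector"
  assumes M: "vector_cone M" "- u \<notin> M" and total: "\<And>x. x \<in> M \<or> - x \<in> M"
    and unit: "\<And>x. \<exists>N. N *\<^sub>R u - x \<in> M"
  obtains L :: "'a \<Rightarrow> real" where "linear L" "\<And>x. x \<in> M \<Longrightarrow> 0 \<le> L x" "L u = 1"
proof -
  note cone = vector_coneD[OF M(1)]
  define A where "A x = {r. r *\<^sub>R u - x \<in> M}" for x
  define L where "L x = Inf (A x)" for x
  have neg: "0 \<le> r" if "r *\<^sub>R u \<in> M" for r
  proof (rule ccontr)
    assume "\<not> 0 \<le> r"
    moreover have "(- r) *\<^sub>R (- u) = r *\<^sub>R u" by simp
    ultimately show False
      using that M(2) vector_cone_scale_pos_iff[OF M(1), of "- r" "- u"] by simp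
  qed
  have ne: "A x \<noteq> {}" for x using unit[of x] by (auto simp: A_def)
  have bdd: "bdd_below (A x)" for x
  proof -
    obtain N where N: "N *\<^sub>R u - (- x) \<in> M" using unit by blast
    have "- N \<le> r" if "r \<in> A x" for r
    proof -
      have "(r *\<^sub>R u - x) + (N *\<^sub>R u - (- x)) \<in> M"
        using that by (intro cone(2) N) (simp add: A_def)
      also have "(r *\<^sub>R u - x) + (N *\<^sub>R u - (- x)) = (r + N) *\<^sub>R u" by (simp add: algebra_simps)
      finally show ?thesis using neg by fastforce
    qed
    then show ?thesis by (rule bdd_belowI)
  qed
  have le: "L x \<le> r" if "r \<in> A x" for x r
    unfolding L_def using that bdd by (rule cInf_lower)
  have ge: "r \<le> L x" if "\<And>s. s \<in> A x \<Longrightarrow> r \<le> s" for x r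
    unfolding L_def using ne that by (rule cInf_greatest)
  have sub: "L (x + y) \<le> L x + L y" for x y
  proof -
    have "L (x + y) - r \<le> L y" if r: "r \<in> A x" for r
    proof (rule ge)
      fix s assume "s \<in> A y"
      then have "(r *\<^sub>R u - x) + (s *\<^sub>R u - y) \<in> M" using r cone(2) by (simp add: A_def)
      also have "(r *\<^sub>R u - x) + (s *\<^sub>R u - y) = (r + s) *\<^sub>R u - (x + y)"
        by (simp add: algebra_simps)
      finally have "L (x + y) \<le> r + s" by (intro le) (simp add: A_def)
      then show "L (x + y) - r \<le> s" by simp
    qed
    then have "L (x + y) - L y \<le> L x" by (intro ge) (auto simp: algebra_simps)
    then show ?thesis by simp
  qed
  have minus: "L (- x) \<le> - L x" for x
  proof (rule dense_le)
    \<comment> \<open>totality turns the failure of \<open>s u + x \<in> M\<close> into membership of the negative\<close>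
    fix s assume "s < L (- x)"
    then have "s \<notin> A (- x)" using le by (auto simp: not_less[symmetric])
    then have "- (s *\<^sub>R u + x) \<in> M" using total[of "s *\<^sub>R u + x"] by (simp add: A_def)
    then have "- s \<in> A x" by (simp add: A_def)
    then show "s \<le> - L x" using le by fastforce
  qed
  have add: "L (x + y) = L x + L y" for x y
    using sub[of x y] sub[of "x + y" "- y"] minus[of y] by simp
  have scale_le: "L (c *\<^sub>R x) \<le> c * L x" if "0 < c" for c x
  proof -
    have "L (c *\<^sub>R x) / c \<le> L x"
    proof (rule ge)
      fix s assume "s \<in> A x"
      then have "c *\<^sub>R (s *\<^sub>R u - x) \<in> M" using that by (simp add: A_def cone(3))
      then have "c * s \<in> A (c *\<^sub>R x)" by (simp add: A_def algebra_simps)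
      then show "L (c *\<^sub>R x) / c \<le> s" using le that by (fastforce simp: field_simps)
    qed
    then show ?thesis using that by (simp add: field_simps)
  qed
  have scale_pos: "L (c *\<^sub>R x) = c * L x" if "0 < c" for c x
  proof (rule antisym[OF scale_le[OF that]])
    have "L (inverse c *\<^sub>R (c *\<^sub>R x)) \<le> inverse c * L (c *\<^sub>R x)" using that by (intro scale_le) auto
    then show "c * L x \<le> L (c *\<^sub>R x)" using that by (simp add: field_simps)
  qed
  have zero: "L 0 = 0" using add[of 0 0] by simp
  have uminus: "L (- x) = - L x" for x using add[of x "- x"] zero by simp
  have "L (c *\<^sub>R x) = c * L x" for c x
  proof (cases c "0::real" rule: linorder_cases)
    case less
    then show ?thesis using scale_pos[of "- c" x] uminus[of "c *\<^sub>R x"] by simp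
  qed (use scale_pos zero in auto)
  then have "linear L" by (intro linearI) (simp_all add: add)
  moreover have "0 \<le> L x" if "x \<in> M" for x
  proof (rule ge)
    fix r assume "r \<in> A x"
    then have "(r *\<^sub>R u - x) + x \<in> M" by (intro cone(2)[OF _ that]) (simp add: A_def)
    then show "0 \<le> r" using neg by simp
  qed
  moreover have "L u = 1"
  proof (rule antisym)
    show "L u \<le> 1" by (rule le) (simp add: A_def cone(1))
    show "1 \<le> L u"
    proof (rule ge)
      fix r assume "r \<in> A u"
      then have "(r - 1) *\<^sub>R u \<in> M" by (simp add: A_def algebra_simps)
      then show "1 \<le> r" using neg by fastforce
    qed
  qed
  ultimately show ?thesis using that by blast
qed

text \<open>
  The point \<open>a\<close> is separated by adjoining \<open>- a\<close> to the cone.  This does not produce \<open>- u\<close>: otherwise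
  \<open>u\<close> plus an element of the cone would be a nonnegative multiple of \<open>a\<close>, so that \<open>a\<close> would be in the
  cone.
\<close>

lemma vector_cone_separation:
  fixes a u :: "'a::real_vector"
  assumes C: "vector_cone C" and u: "u \<in> C" and unit: "\<And>x. \<exists>N. N *\<^sub>R u - x \<in> C" and a: "a \<notin> C"
  obtains L :: "'a \<Rightarrow> real"
  where "linear L" "\<And>x. x \<in> C \<Longrightarrow> 0 \<le> L x" "L u = 1" "L a \<le> 0"
proof -
  note cone = vector_coneD[OF C]
  let ?D = "{x + c *\<^sub>R (- a) | x c. x \<in> C \<and> 0 \<le> c}"
  have "- u \<notin> ?D"
  proof
    assume "- u \<in> ?D"
    then obtain x c where x: "- u = x + c *\<^sub>R (- a)" "x \<in> C" "0 \<le> c" by blast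
    have ca: "c *\<^sub>R a \<in> C"
    proof -
      have "c *\<^sub>R a = x + u" using x(1) by (simp add: algebra_simps add_eq_0_iff)
      then show ?thesis using cone(2) x(2) u by simp
    qed
    show False
    proof (cases "c = 0")
      case True
      then have mu: "- u \<in> C" using x by simp
      obtain N where N: "N *\<^sub>R u - (- a) \<in> C" using unit by blast
      have "(- N) *\<^sub>R u \<in> C"
      proof (cases "0 \<le> N")
        case True
        then have "N *\<^sub>R (- u) \<in> C" using mu cone(3) by blast
        then show ?thesis by simp
      next
        case False
        then show ?thesis using u cone(3)[of "- N" u] by simp
      qed
      from cone(2)[OF this N] show False using a by simp
    next
      case False
      then show False using ca vector_cone_scale_pos_iff[OF C, of c a] x(3) a by simp
    qed
  qed
  then obtain M where M: "vector_cone M" "?D \<subseteq> M" "- u \<notin> M" "\<And>x. x \<in> M \<or> - x \<in> M"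
    using exists_total_vector_cone[OF vector_cone_add_ray[OF C]] by blast
  have CM: "C \<subseteq> M"
  proof
    fix x assume "x \<in> C"
    then have "x \<in> ?D" by (intro CollectI exI[of _ x] exI[of _ 0]) auto
    then show "x \<in> M" using M(2) by blast
  qed
  have "- a = 0 + 1 *\<^sub>R (- a)" by simp
  then have "- a \<in> ?D" using cone(1) zero_le_one by blast
  then have aM: "- a \<in> M" using M(2) by blast
  have "\<exists>N. N *\<^sub>R u - x \<in> M" for x using unit CM by blast
  then obtain L :: "'a \<Rightarrow> real" where L: "linear L" "\<And>x. x \<in> M \<Longrightarrow> 0 \<le> L x" "L u = 1"
    using total_vector_cone_functional[OF M(1,3,4)] by blast
  moreover have "L a \<le> 0" using L(2)[OF aM] linear_neg[OF L(1), of a] by simp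
  ultimately show ?thesis using that CM by blast
qed

section \<open>Preorders\<close>

lemma mult_prod_in:
  assumes "\<And>x y. x \<in> S \<Longrightarrow> y \<in> S \<Longrightarrow> x * y \<in> S" "\<And>i. i \<in> e \<Longrightarrow> r i \<in> S" "finite e" "x \<in> S"
  shows "x * prod r e \<in> (S :: 'a::comm_ring_1 set)"
  using assms(3,2,4)
proof (induction e arbitrary: x rule: finite_induct)
  case (insert i e)
  then have "(x * r i) * prod r e \<in> S" by (simp add: assms(1))
  then show ?case using insert by (simp add: mult.assoc)
qed simp

lemma mult_power_in:
  assumes "\<And>x y. x \<in> S \<Longrightarrow> y \<in> S \<Longrightarrow> x * y \<in> S" "x \<in> S" "y \<in> S"
  shows "x * y ^ n \<in> (S :: 'a::comm_ring_1 set)"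
proof (induction n)
  case (Suc n)
  then show ?case using assms(1)[OF Suc assms(3)] by (simp add: ac_simps)
qed (simp add: assms)

lemma sums_of_squares_add:
  assumes "x \<in> sums_of_squares S" "y \<in> sums_of_squares S"
  shows "x + y \<in> sums_of_squares S"
proof -
  obtain xs ys where "x = (\<Sum>x\<leftarrow>xs. x\<^sup>2)" "y = (\<Sum>x\<leftarrow>ys. x\<^sup>2)" "set xs \<subseteq> S" "set ys \<subseteq> S"
    using assms by (auto simp: sums_of_squares_def)
  then have "x + y = (\<Sum>x\<leftarrow>xs @ ys. x\<^sup>2)" "set (xs @ ys) \<subseteq> S" by auto
  then show ?thesis unfolding sums_of_squares_def by blast
qed

lemma zero_in_sums_of_squares: "0 \<in> sums_of_squares S"
  unfolding sums_of_squares_def by (intro CollectI exI[of _ "[]"]) simp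

lemma preorder_generated_zero: "0 \<in> preorder_generated S I r"
  unfolding preorder_generated_def
  by (intro CollectI exI[of _ "\<lambda>_. 0"]) (simp add: zero_in_sums_of_squares)

lemma preorder_generated_add:
  assumes "x \<in> preorder_generated S I r" "y \<in> preorder_generated S I r"
  shows "x + y \<in> preorder_generated S I r"
proof -
  obtain \<sigma> \<tau> where x: "x = (\<Sum>e\<in>Pow I. \<sigma> e * (\<Prod>i\<in>e. r i))"
    and y: "y = (\<Sum>e\<in>Pow I. \<tau> e * (\<Prod>i\<in>e. r i))"
    and "\<forall>e\<in>Pow I. \<sigma> e \<in> sums_of_squares S" "\<forall>e\<in>Pow I. \<tau> e \<in> sums_of_squares S"
    using assms by (auto simp: preorder_generated_def)
  then have "\<forall>e\<in>Pow I. \<sigma> e + \<tau> e \<in> sums_of_squares S" by (auto intro: sums_of_squares_add)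
  moreover have "x + y = (\<Sum>e\<in>Pow I. (\<sigma> e + \<tau> e) * (\<Prod>i\<in>e. r i))"
    by (simp add: x y algebra_simps sum.distrib)
  ultimately show ?thesis
    unfolding preorder_generated_def by (intro CollectI exI[of _ "\<lambda>e. \<sigma> e + \<tau> e"]) simp
qed

lemma preorder_generated_term:
  assumes "finite I" "e \<subseteq> I" "b \<in> S"
  shows "b\<^sup>2 * prod r e \<in> preorder_generated S I r"
proof -
  define \<sigma> where "\<sigma> f = (if f = e then b\<^sup>2 else 0)" for f
  have "b\<^sup>2 \<in> sums_of_squares S"
    unfolding sums_of_squares_def using assms(3) by (intro CollectI exI[of _ "[b]"]) simp
  then have "\<forall>f\<in>Pow I. \<sigma> f \<in> sums_of_squares S" by (simp add: \<sigma>_def zero_in_sums_of_squares)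
  moreover have "b\<^sup>2 * prod r e = (\<Sum>f\<in>Pow I. \<sigma> f * (\<Prod>i\<in>f. r i))"
  proof -
    have "(\<Sum>f\<in>Pow I. \<sigma> f * (\<Prod>i\<in>f. r i)) = (\<Sum>f\<in>Pow I. if f = e then b\<^sup>2 * prod r e else 0)"
      by (intro sum.cong) (auto simp: \<sigma>_def)
    then show ?thesis using assms(1,2) by simp
  qed
  ultimately show ?thesis unfolding preorder_generated_def by blast
qed

text \<open>
  The products of a square and some generators generate the preorder additively, so that statements
  about it reduce to such products.
\<close>

lemma preorder_generated_induct [consumes 2, case_names zero add gen]:
  assumes "x \<in> preorder_generated S I r" "finite I"
    and zero: "Q 0" and add: "\<And>x y. Q x \<Longrightarrow> Q y \<Longrightarrow> Q (x + y)"
    and gen: "\<And>b e. b \<in> S \<Longrightarrow> e \<subseteq> I \<Longrightarrow> Q (b\<^sup>2 * prod r e)"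
  shows "Q x"
proof -
  obtain \<sigma> where x: "x = (\<Sum>e\<in>Pow I. \<sigma> e * prod r e)"
    and \<sigma>: "\<forall>e\<in>Pow I. \<sigma> e \<in> sums_of_squares S"
    using assms(1) by (auto simp: preorder_generated_def)
  have summand: "Q (\<sigma> e * prod r e)" if e: "e \<in> Pow I" for e
  proof -
    have "\<sigma> e \<in> sums_of_squares S" using \<sigma> e by blast
    then obtain xs where xs: "\<sigma> e = (\<Sum>x\<leftarrow>xs. x\<^sup>2)" "set xs \<subseteq> S"
      by (auto simp: sums_of_squares_def)
    from xs(2) have "Q ((\<Sum>x\<leftarrow>xs. x\<^sup>2) * prod r e)"
      by (induction xs) (use zero add gen e in \<open>auto simp: distrib_right\<close>)
    then show ?thesis by (simp add: xs(1))
  qed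
  have "Q (\<Sum>e\<in>E. \<sigma> e * prod r e)" if "finite E" "E \<subseteq> Pow I" for E
    using that by (induction E rule: finite_induct) (auto simp: zero add summand)
  then show ?thesis using x assms(2) by simp
qed

text \<open>
  In a product of two generators of the cone, the factors \<open>r i\<close> that occur twice are moved into the
  square.
\<close>

lemma preorder_generated_mult:
  assumes S: "\<And>x y. x \<in> S \<Longrightarrow> y \<in> S \<Longrightarrow> x * y \<in> S" and r: "\<And>i. i \<in> I \<Longrightarrow> r i \<in> S"
    and I: "finite I"
    and x: "x \<in> preorder_generated S I r" and y: "y \<in> preorder_generated S I r"
  shows "x * y \<in> preorder_generated S I r"
  using x I
proof (induction rule: preorder_generated_induct)
  case zero
  then show ?case by (simp add: preorder_generated_zero)
next
  case (add x x')
  then show ?case by (simp add: distrib_right preorder_generated_add)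
next
  case (gen b e)
  show ?case
    using y I
  proof (induction rule: preorder_generated_induct)
    case zero
    then show ?case by (simp add: preorder_generated_zero)
  next
    case (add y y')
    then show ?case by (simp add: distrib_left preorder_generated_add)
  next
    case (gen c f)
    have fin: "finite e" "finite f" using \<open>e \<subseteq> I\<close> \<open>f \<subseteq> I\<close> I finite_subset by auto
    have "prod r e * prod r f = prod r (e \<union> f) * prod r (e \<inter> f)"
      using fin by (simp add: prod.union_inter)
    also have "prod r (e \<union> f) = prod r (e \<union> f - e \<inter> f) * prod r (e \<inter> f)"
      using fin by (intro prod.subset_diff) auto
    finally have "b\<^sup>2 * prod r e * (c\<^sup>2 * prod r f)
        = (b * c * prod r (e \<inter> f))\<^sup>2 * prod r (e \<union> f - e \<inter> f)"
      by (simp add: power2_eq_square algebra_simps)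
    moreover have "b * c * prod r (e \<inter> f) \<in> S"
      using S r fin \<open>b \<in> S\<close> \<open>c \<in> S\<close> \<open>e \<subseteq> I\<close> by (intro mult_prod_in) auto
    moreover have "e \<union> f - e \<inter> f \<subseteq> I" using \<open>e \<subseteq> I\<close> \<open>f \<subseteq> I\<close> by blast
    ultimately show ?case using I by (simp add: preorder_generated_term)
  qed
qed

section \<open>Functionals that are positive on squares\<close>

text \<open>
  The quadratic form \<open>(\<alpha>, \<beta>) \<mapsto> L ((\<alpha> x + \<beta> y)\<^sup>2 q)\<close> is nonnegative, hence its discriminant is not
  positive.
\<close>

lemma weighted_Cauchy_Schwarz:
  fixes L :: "'a::{real_algebra_1, comm_ring_1} \<Rightarrow> real"
  assumes L: "linear L" and pos: "\<And>\<alpha> \<beta>. 0 \<le> L ((\<alpha> *\<^sub>R x + \<beta> *\<^sub>R y)\<^sup>2 * q)"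
  shows "(L (x * y * q))\<^sup>2 \<le> L (x\<^sup>2 * q) * L (y\<^sup>2 * q)"
proof -
  define A B C where "A = L (x\<^sup>2 * q)" "B = L (x * y * q)" "C = L (y\<^sup>2 * q)"
  have quad: "0 \<le> \<alpha>\<^sup>2 * A + 2 * \<alpha> * \<beta> * B + \<beta>\<^sup>2 * C" for \<alpha> \<beta>
  proof -
    have "(\<alpha> *\<^sub>R x + \<beta> *\<^sub>R y)\<^sup>2 * q
        = \<alpha>\<^sup>2 *\<^sub>R (x\<^sup>2 * q) + ((\<alpha> * \<beta>) *\<^sub>R (x * y * q) + (\<alpha> * \<beta>) *\<^sub>R (x * y * q))
          + \<beta>\<^sup>2 *\<^sub>R (y\<^sup>2 * q)"
      by (simp add: power2_eq_square algebra_simps)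
    then have "L ((\<alpha> *\<^sub>R x + \<beta> *\<^sub>R y)\<^sup>2 * q)
        = \<alpha>\<^sup>2 * A + (\<alpha> * \<beta> * B + \<alpha> * \<beta> * B) + \<beta>\<^sup>2 * C"
      by (simp only: linear_add[OF L] linear_scale[OF L] A_B_C_def real_scaleR_def)
    then show ?thesis using pos[of \<alpha> \<beta>] by (simp add: ac_simps)
  qed
  have "0 \<le> C" using quad[of 0 1] by simp
  have "B\<^sup>2 \<le> A * C"
  proof (cases "C = 0")
    case True
    \<comment> \<open>now the form is linear in \<open>\<beta>\<close>; for \<open>B \<noteq> 0\<close> this choice of \<open>\<beta>\<close> gives it the value \<open>- 1\<close>\<close>
    have "B = 0"
    proof (rule ccontr)
      assume "B \<noteq> 0"
      then have "1\<^sup>2 * A + 2 * 1 * (- (A + 1) / (2 * B)) * B = - 1" by (simp add: field_simps)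
      then show False using quad[of 1 "- (A + 1) / (2 * B)"] True by simp
    qed
    then show ?thesis using True by simp
  next
    case False
    then have "0 < C" using \<open>0 \<le> C\<close> by simp
    have "0 \<le> C * (A * C - B\<^sup>2)" using quad[of C "- B"] by (simp add: power2_eq_square algebra_simps)
    then show ?thesis using \<open>0 < C\<close> by (simp add: zero_le_mult_iff)
  qed
  then show ?thesis by (simp add: A_B_C_def)
qed

text \<open>
  After normalizing \<open>s 0 = 1\<close>, the first inequality gives \<open>\<bar>s 1\<bar> ^ (2 ^ n) \<le> \<bar>s (2 ^ n)\<bar> \<le> C * d ^ (2 ^ n)\<close>
  for all \<open>n\<close>, which bounds the powers of \<open>\<bar>s 1\<bar> / d\<close>; so this number is at most 1, whatever \<open>C\<close> is.
\<close>

lemma moment_growth_bound: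
  fixes s :: "nat \<Rightarrow> real"
  assumes conv: "\<And>n. (s n)\<^sup>2 \<le> s 0 * s (2 * n)" and s0: "0 \<le> s 0"
    and bound: "\<And>n. \<bar>s n\<bar> \<le> C * d ^ n" and d: "0 < d"
  shows "\<bar>s 1\<bar> \<le> d * s 0"
proof (cases "s 0 = 0")
  case True
  then show ?thesis using conv[of 1] by simp
next
  case False
  then have s0: "0 < s 0" using s0 by simp
  define x where "x = \<bar>s 1\<bar> / (d * s 0)"
  have power: "s 0 * (\<bar>s 1\<bar> / s 0) ^ (2 ^ n) \<le> \<bar>s (2 ^ n)\<bar>" for n
  proof (induction n)
    case 0
    then show ?case using s0 by simp
  next
    case (Suc n)
    have "(s 0 * (\<bar>s 1\<bar> / s 0) ^ (2 ^ n))\<^sup>2 \<le> \<bar>s (2 ^ n)\<bar>\<^sup>2"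
      using Suc s0 by (intro power_mono) auto
    also have "\<dots> \<le> s 0 * \<bar>s (2 ^ Suc n)\<bar>"
      using conv[of "2 ^ n"] s0 by (simp add: order_trans[OF _ mult_left_mono])
    also have "(s 0 * (\<bar>s 1\<bar> / s 0) ^ (2 ^ n))\<^sup>2 = s 0 * (s 0 * (\<bar>s 1\<bar> / s 0) ^ (2 ^ Suc n))"
      by (simp only: power_mult_distrib power_mult[symmetric] power_Suc)
        (simp add: power2_eq_square mult.commute)
    finally show ?case using s0 by simp
  qed
  have xn: "x ^ n \<le> C / s 0" if "1 < x" for n
  proof -
    have "x ^ n \<le> x ^ (2 ^ n)" using that by (intro power_increasing) auto
    also have "x ^ (2 ^ n) = (\<bar>s 1\<bar> / s 0) ^ (2 ^ n) / d ^ (2 ^ n)"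
      by (simp add: x_def power_divide power_mult_distrib mult.commute)
    also have "\<dots> \<le> C / s 0"
      using order_trans[OF power[of n] bound] s0 d by (simp add: field_simps)
    finally show ?thesis .
  qed
  have "x \<le> 1"
  proof (rule ccontr)
    assume "\<not> x \<le> 1"
    then obtain n where "C / s 0 < x ^ n" using real_arch_pow[of x] by auto
    then show False using xn[of n] \<open>\<not> x \<le> 1\<close> by simp
  qed
  then show ?thesis using s0 d by (simp add: x_def field_simps)
qed

text \<open>
  By induction on the number of generators in a product \<open>q\<close>, the form \<open>b \<mapsto> L (b\<^sup>2 q)\<close> is nonnegative
  on \<open>S\<close>.  When the factor \<open>d u + z\<close> is added, the moments \<open>L (b\<^sup>2 q z\<^sup>m)\<close> have to be bounded; by the
  unweighted Cauchy-Schwarz inequality this needs only the bounds for the even moments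
  \<open>L (u z ^ (2 m))\<close> of \<open>z\<close> itself.  The algebra \<open>S\<close> has its own identity \<open>u\<close>, in view of the algebras of
  \<open>k\<close>-labeled graphs.
\<close>

lemma positive_on_preorder:
  fixes L :: "'a::{real_algebra_1, comm_ring_1} \<Rightarrow> real"
  assumes L: "linear L"
    and S_add: "\<And>x y. x \<in> S \<Longrightarrow> y \<in> S \<Longrightarrow> x + y \<in> S"
    and S_mult: "\<And>x y. x \<in> S \<Longrightarrow> y \<in> S \<Longrightarrow> x * y \<in> S"
    and S_scale: "\<And>c x. x \<in> S \<Longrightarrow> c *\<^sub>R x \<in> S"
    and u: "u \<in> S" "\<And>x. x \<in> S \<Longrightarrow> u * x = x"
    and pos: "\<And>x. x \<in> S \<Longrightarrow> 0 \<le> L (x\<^sup>2)"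
    and I: "finite I" and d: "0 < d"
    and z: "\<And>i. i \<in> I \<Longrightarrow> z i \<in> S" "\<And>i. i \<in> I \<Longrightarrow> r i = d *\<^sub>R u + z i"
    and bound: "\<And>i m. i \<in> I \<Longrightarrow> \<bar>L (u * z i ^ m)\<bar> \<le> d ^ m"
    and x: "x \<in> preorder_generated S I r"
  shows "0 \<le> L x"
proof -
  have rS: "r i \<in> S" if "i \<in> I" for i using that z u(1) S_add S_scale by simp
  have posr: "0 \<le> L (b\<^sup>2 * prod r e)" if "finite e" "e \<subseteq> I" "b \<in> S" for b e
    using that
  proof (induction e arbitrary: b rule: finite_induct)
    case empty
    then show ?case by (simp add: pos)
  next
    case (insert i e)
    define q where "q = prod r e"
    have i: "i \<in> I" and b: "b \<in> S" using insert by auto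
    have IH: "0 \<le> L (c\<^sup>2 * q)" if "c \<in> S" for c
      using insert that by (simp add: q_def)
    have bz: "b * z i ^ m \<in> S" "u * z i ^ m \<in> S" for m
      using b u(1) z(1)[OF i] by (simp_all add: mult_power_in S_mult)
    have X: "b\<^sup>2 * q \<in> S"
      unfolding q_def power2_eq_square using rS insert b
      by (intro mult_prod_in S_mult) auto
    define s where "s m = L (b\<^sup>2 * q * z i ^ m)" for m
    have "\<bar>s 1\<bar> \<le> d * s 0"
    proof (rule moment_growth_bound[OF _ _ _ d])
      show "(s n)\<^sup>2 \<le> s 0 * s (2 * n)" for n
      proof -
        have "(L (b * (b * z i ^ n) * q))\<^sup>2 \<le> L (b\<^sup>2 * q) * L ((b * z i ^ n)\<^sup>2 * q)"
          using b bz by (intro weighted_Cauchy_Schwarz[OF L] IH S_add S_scale)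
        then show ?thesis
          by (simp add: s_def power2_eq_square mult_2_right power_add ac_simps)
      qed
      show "0 \<le> s 0" using IH b by (simp add: s_def)
      show "\<bar>s n\<bar> \<le> sqrt (L ((b\<^sup>2 * q)\<^sup>2)) * d ^ n" for n
      proof -
        have "b\<^sup>2 * q * (u * z i ^ n) = (u * (b\<^sup>2 * q)) * z i ^ n"
          by (simp add: ac_simps)
        then have eq: "b\<^sup>2 * q * (u * z i ^ n) = b\<^sup>2 * q * z i ^ n"
          using u(2)[OF X] by simp
        have uu: "(u * z i ^ n)\<^sup>2 = u * z i ^ (2 * n)"
        proof -
          have "(u * z i ^ n)\<^sup>2 = (u * u) * z i ^ (2 * n)"
            by (simp add: power2_eq_square mult_2_right power_add ac_simps)
          then show ?thesis using u by simp
        qed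
        have "(L (b\<^sup>2 * q * (u * z i ^ n) * 1))\<^sup>2 \<le> L ((b\<^sup>2 * q)\<^sup>2 * 1) * L ((u * z i ^ n)\<^sup>2 * 1)"
          using X bz(2) pos by (intro weighted_Cauchy_Schwarz[OF L]) (simp add: S_add S_scale)
        then have "(s n)\<^sup>2 \<le> L ((b\<^sup>2 * q)\<^sup>2) * L (u * z i ^ (2 * n))"
          by (simp only: eq uu mult_1_right s_def)
        also have "\<dots> \<le> L ((b\<^sup>2 * q)\<^sup>2) * d ^ (2 * n)"
          using bound[OF i, of "2 * n"] pos[OF X] by (intro mult_left_mono) auto
        finally have "(s n)\<^sup>2 \<le> L ((b\<^sup>2 * q)\<^sup>2) * (d ^ n)\<^sup>2"
          by (simp add: power_mult[symmetric] mult.commute)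
        from real_sqrt_le_mono[OF this] show ?thesis using d by (simp add: real_sqrt_mult)
      qed
    qed
    moreover have "L (b\<^sup>2 * prod r (insert i e)) = d * s 0 + s 1"
    proof -
      have bu: "u * b\<^sup>2 = b\<^sup>2" using u(2) b S_mult by (simp add: power2_eq_square)
      have "b\<^sup>2 * prod r (insert i e) = d *\<^sub>R ((u * b\<^sup>2) * q) + b\<^sup>2 * q * z i"
        using insert z(2)[OF i] by (simp add: q_def algebra_simps)
      then show ?thesis by (simp add: bu linear_add[OF L] linear_scale[OF L] s_def)
    qed
    ultimately show ?case by simp
  qed
  show ?thesis using x I
  proof (induction rule: preorder_generated_induct)
    case (gen b e)
    then show ?case using posr I finite_subset by blast
  qed (auto simp: linear_0[OF L] linear_add[OF L])
qed

section \<open>The real vector space of finitely supported functions\<close>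

instantiation poly_mapping :: (type, real_vector) real_vector
begin

lift_definition scaleR_poly_mapping :: "real \<Rightarrow> ('a \<Rightarrow>\<^sub>0 'b) \<Rightarrow> 'a \<Rightarrow>\<^sub>0 'b"
  is "\<lambda>c f x. c *\<^sub>R f x"
  by (rule finite_subset[rotated]) auto

instance
  by standard (transfer; simp add: algebra_simps)+

end

lemma lookup_scaleR [simp]:
  "Poly_Mapping.lookup (c *\<^sub>R p) x = c *\<^sub>R Poly_Mapping.lookup p x"
  by (simp add: scaleR_poly_mapping.rep_eq)

lemma scaleR_single: "c *\<^sub>R Poly_Mapping.single x y = Poly_Mapping.single x (c *\<^sub>R y)"
  by (rule poly_mapping_eqI) (simp add: lookup_single when_def)

lemma scaleR_eq_single_mult:
  "c *\<^sub>R p = Poly_Mapping.single 0 (of_real c) * (p :: 'a::comm_monoid_add \<Rightarrow>\<^sub>0 'b::real_algebra_1)"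
proof -
  have "Poly_Mapping.map ((*) (of_real c)) p = c *\<^sub>R p"
    by (rule poly_mapping_eqI) (simp add: map.rep_eq when_def scaleR_conv_of_real)
  then show ?thesis by (simp add: mult_map_scale_conv_mult)
qed

instance poly_mapping ::
  (comm_monoid_add, "{real_algebra_1, comm_ring_1}") real_algebra_1
  by standard (simp_all add: scaleR_eq_single_mult ac_simps)

lemma poly_mapping_expansion:
  "(a :: 'a \<Rightarrow>\<^sub>0 real) =
    (\<Sum>G\<in>Poly_Mapping.keys a. Poly_Mapping.lookup a G *\<^sub>R Poly_Mapping.single G 1)"
  by (rule poly_mapping_eqI) (simp add: lookup_sum lookup_single when_def in_keys_iff if_distrib
      cong: if_cong)

text \<open>
  The linear map with prescribed values on the basis; forgetting labels and extending a graph
  parameter are of this form.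
\<close>

lemma linear_extension:
  fixes f :: "'a \<Rightarrow> 'b::real_vector"
  shows "linear (\<lambda>a. \<Sum>G\<in>Poly_Mapping.keys a. Poly_Mapping.lookup a G *\<^sub>R f G)" (is "linear ?T")
proof (rule linearI)
  have T: "?T a = (\<Sum>G\<in>S. Poly_Mapping.lookup a G *\<^sub>R f G)"
    if "finite S" "Poly_Mapping.keys a \<subseteq> S" for a and S :: "'a set"
    using that by (intro sum.mono_neutral_left) (auto simp: in_keys_iff)
  fix a b :: "'a \<Rightarrow>\<^sub>0 real" and c :: real
  let ?S = "Poly_Mapping.keys a \<union> Poly_Mapping.keys b"
  have "?T (a + b) = (\<Sum>G\<in>?S. Poly_Mapping.lookup (a + b) G *\<^sub>R f G)"
    by (rule T) (auto simp: Poly_Mapping.keys_add)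
  also have "\<dots> = ?T a + ?T b"
    by (simp add: T[of ?S] lookup_add scaleR_add_left sum.distrib)
  finally show "?T (a + b) = ?T a + ?T b" .
  have "Poly_Mapping.keys (c *\<^sub>R a) \<subseteq> Poly_Mapping.keys a" by (auto simp: in_keys_iff)
  then show "?T (c *\<^sub>R a) = c *\<^sub>R ?T a"
    by (subst T[of "Poly_Mapping.keys a" "c *\<^sub>R a"]) (simp_all add: scaleR_sum_right)
qed

lemma linear_eq_on_singles:
  fixes f g :: "('a \<Rightarrow>\<^sub>0 real) \<Rightarrow> 'b::real_vector"
  assumes "linear f" "linear g"
    and "\<And>G. G \<in> Poly_Mapping.keys a \<Longrightarrow> f (Poly_Mapping.single G 1) = g (Poly_Mapping.single G 1)"
  shows "f a = g a"
proof -
  have "f (\<Sum>G\<in>Poly_Mapping.keys a. Poly_Mapping.lookup a G *\<^sub>R Poly_Mapping.single G 1)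
      = g (\<Sum>G\<in>Poly_Mapping.keys a. Poly_Mapping.lookup a G *\<^sub>R Poly_Mapping.single G 1)"
    using assms(3) by (simp add: linear_sum[OF assms(1)] linear_sum[OF assms(2)]
        linear_scale[OF assms(1)] linear_scale[OF assms(2)])
  then show ?thesis by (simp flip: poly_mapping_expansion)
qed

lemma linear_in_subspace:
  fixes f :: "('a \<Rightarrow>\<^sub>0 real) \<Rightarrow> 'b::real_vector"
  assumes "linear f" "subspace U"
    and "\<And>G. G \<in> Poly_Mapping.keys a \<Longrightarrow> f (Poly_Mapping.single G 1) \<in> U"
  shows "f a \<in> U"
proof -
  have "f (\<Sum>G\<in>Poly_Mapping.keys a. Poly_Mapping.lookup a G *\<^sub>R Poly_Mapping.single G 1) \<in> U"
    unfolding linear_sum[OF assms(1)] linear_scale[OF assms(1)]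
    using assms(2,3) by (intro subspace_sum subspace_scale)
  then show ?thesis by (simp flip: poly_mapping_expansion)
qed

section \<open>Representatives of labeled graphs\<close>

lemma abs_lgraph_eqI: "graph_iso g h \<Longrightarrow> abs_lgraph g = abs_lgraph h"
  using Quotient_rel_abs[OF Quotient_lgraph] .

lemma lgraph_exhaust:
  obtains g where "wf_graph g" "G = abs_lgraph g"
  by (metis Quotient_lgraph Quotient_rep_reflp Quotient_abs_rep graph_iso_def)

text \<open>
  Names of unlabeled vertices are irrelevant.  Two injective renamings are compared, rather than a
  renaming with the original graph, since they may remove labels.
\<close>

lemma abs_lgraph_renaming:
  assumes g: "wf_graph g" and f: "inj_on f (fst g)" "f ` fst g \<inter> range Lab = {}"
    and f': "inj_on f' (fst g)" "f' ` fst g \<inter> range Lab = {}"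
  shows "abs_lgraph (map_graph f g) = abs_lgraph (map_graph f' g)"
proof (intro abs_lgraph_eqI graph_isoI)
  let ?F = "f' \<circ> inv_into (fst g) f"
  have inv: "?F (f v) = f' v" if "v \<in> fst g" for v using f(1) that by simp
  have fst: "fst (map_graph f g) = f ` fst g" by (simp add: map_graph_def)
  have "card (f ` e) = 2" if "e \<in># snd g" for e
    using that g f(1) unfolding wf_graph_def by (metis card_image inj_on_subset)
  then show "wf_graph (map_graph f g)" using g by (auto simp: wf_graph_def map_graph_def)
  show "inj_on ?F (fst (map_graph f g))"
    using f'(1) inv unfolding fst inj_on_def by auto
  show "?F v = Lab i \<longleftrightarrow> v = Lab i" if "v \<in> fst (map_graph f g)" for v i
    using that inv f(2) f'(2) unfolding fst by auto
  show "map_graph f' g = map_graph ?F (map_graph f g)"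
    unfolding map_graph_comp using g inv by (intro map_graph_cong) auto
qed

lemma inj_unlabel_vertex: "inj unlabel_vertex"
proof (rule injI)
  fix x y show "unlabel_vertex x = unlabel_vertex y \<Longrightarrow> x = y"
    by (cases x; cases y; simp) presburger+
qed

lemma unlabel_vertex_neq_Lab [simp]: "unlabel_vertex v \<noteq> Lab i"
  by (cases v) auto

lemma unlabel_abs_lgraph:
  "wf_graph g \<Longrightarrow> unlabel (abs_lgraph g) = abs_lgraph (map_graph unlabel_vertex g)"
  by (simp add: unlabel.abs_eq graph_iso_refl)

lemma labels_abs_lgraph: "wf_graph g \<Longrightarrow> labels (abs_lgraph g) = {i. Lab i \<in> fst g}"
  by (simp add: labels.abs_eq graph_iso_refl)

lemma unlabel_in_graphs_0: "unlabel G \<in> graphs 0"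
proof -
  obtain g where g: "wf_graph g" "G = abs_lgraph g" by (rule lgraph_exhaust)
  then have "labels (unlabel G) = {}"
    using wf_map[OF g(1) inj_unlabel_vertex]
    by (auto simp: unlabel_abs_lgraph labels_abs_lgraph map_graph_def dest: sym)
  then show ?thesis by (simp add: graphs_def)
qed

lemma plus_abs_lgraph:
  "wf_graph g \<Longrightarrow> wf_graph h \<Longrightarrow> abs_lgraph g + abs_lgraph h = abs_lgraph (glue g h)"
  by (simp add: plus_lgraph.abs_eq graph_iso_refl)

lemma plus_abs_lgraph_labeled:
  assumes "wf_graph g" "wf_graph h" "fst g \<subseteq> range Lab" "fst h \<subseteq> range Lab"
  shows "abs_lgraph g + abs_lgraph h = abs_lgraph (union_graph g h)"
proof -
  have "map_graph left_vertex g = map_graph id g" "map_graph right_vertex h = map_graph id h"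
    using assms by (auto intro!: map_graph_cong)
  then show ?thesis using assms by (simp add: plus_abs_lgraph glue_def map_graph_id)
qed

text \<open>
  The product with \<^const>\<open>K1\<close> gives the names \<open>Unl (2 * m)\<close> to the old vertices and \<open>Unl 1\<close> to the new
  one.
\<close>

lemma abs_lgraph_insert_isolated:
  assumes wf: "wf_graph (V, E)" and V: "V \<inter> range Lab = {}" and n: "Unl n \<notin> V"
  shows "abs_lgraph (insert (Unl n) V, E) = abs_lgraph (V, E) + K1"
proof -
  let ?f = "\<lambda>w. if w = Unl n then Unl 1 else left_vertex w"
  have wfK: "wf_graph ({Unl 0}, {#})" by (simp add: wf_graph_def)
  have wf': "wf_graph (insert (Unl n) V, E)" using wf by (auto simp: wf_graph_def)
  have left: "left_vertex w \<noteq> Unl 1" for w by (cases w) auto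
  have "graph_iso (insert (Unl n) V, E) (glue (V, E) ({Unl 0}, {#}))"
  proof (rule graph_isoI[OF wf', of ?f])
    show "inj_on ?f (fst (insert (Unl n) V, E))"
      using left inj_left by (intro inj_onI) (metis injD)
    show "?f v = Lab i \<longleftrightarrow> v = Lab i" for v i by auto
    have "image_mset ((`) ?f) E = image_mset ((`) left_vertex) E"
    proof (rule image_mset_cong)
      fix e assume "e \<in># E"
      then have "e \<subseteq> V" using wf by (auto simp: wf_graph_def)
      then show "?f ` e = left_vertex ` e" using n by (intro image_cong) auto
    qed
    moreover have "V \<inter> {w. w \<noteq> Unl n} = V" using n by auto
    ultimately show "glue (V, E) ({Unl 0}, {#}) = map_graph ?f (insert (Unl n) V, E)"
      by (simp add: glue_def union_graph_def map_graph_def)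
  qed
  then show ?thesis
    unfolding K1_def using wf wfK by (simp add: plus_abs_lgraph abs_lgraph_eqI)
qed

lemma isolate_indifferent_add_vertices:
  assumes t: "isolate_indifferent t" and wf: "wf_graph (V, E)" and V: "V \<inter> range Lab = {}"
    and W: "finite W" "W \<inter> range Lab = {}"
  shows "t (abs_lgraph (V \<union> W, E)) = t (abs_lgraph (V, E))"
  using W
proof (induction W rule: finite_induct)
  case (insert w W)
  then obtain n where w: "w = Unl n" by (cases w) auto
  have wfW: "wf_graph (V \<union> W, E)" using wf insert.hyps(1) by (auto simp: wf_graph_def)
  show ?case
  proof (cases "w \<in> V")
    case True
    then show ?thesis using insert by (simp add: insert_absorb)
  next
    case False
    have "abs_lgraph (insert w (V \<union> W), E) = abs_lgraph (V \<union> W, E) + K1"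
      unfolding w using V insert False wfW by (intro abs_lgraph_insert_isolated) (auto simp: w)
    moreover have "abs_lgraph (V \<union> W, E) \<in> graphs 0"
      using wfW V insert.prems by (auto simp: graphs_def labels_abs_lgraph)
    ultimately show ?thesis
      using insert t by (simp add: isolate_indifferent_def)
  qed
qed simp

lemma K2_eq_abs_lgraph:
  assumes "i \<noteq> j"
  shows "K2 m = abs_lgraph ({Unl i, Unl j}, replicate_mset m {Unl i, Unl j})"
proof -
  let ?g = "({Unl 0, Unl 1}, replicate_mset m {Unl 0, Unl 1})"
  let ?f = "\<lambda>v. if v = Unl 0 then Unl i else Unl j"
  have "wf_graph ?g" by (auto simp: wf_graph_def)
  then have "abs_lgraph (map_graph id ?g) = abs_lgraph (map_graph ?f ?g)"
    using assms by (intro abs_lgraph_renaming) auto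
  then show ?thesis by (simp add: K2_def map_graph_id) (simp add: map_graph_def insert_commute)
qed

definition flat_graph :: "nat \<Rightarrow> vertex set multiset \<Rightarrow> lgraph" where
  "flat_graph k E = abs_lgraph (Lab ` {1..k}, E)"

definition flat_edges :: "nat \<Rightarrow> vertex set multiset \<Rightarrow> bool" where
  "flat_edges k E \<longleftrightarrow> wf_graph (Lab ` {1..k}, E)"

lemma edgeless_eq_flat_graph: "edgeless k = flat_graph k {#}"
  by (simp add: edgeless_def flat_graph_def)

lemma edge_graph_eq_flat_graph: "edge_graph k i j = flat_graph k {#{Lab i, Lab j}#}"
  by (simp add: edge_graph_def flat_graph_def)

lemma flat_edges_empty [simp]: "flat_edges k {#}"
  by (simp add: flat_edges_def wf_graph_def)

text \<open>
  The edge variables \<open>z\<^sub>i\<^sub>j\<close> are indexed by \<open>i < j\<close>, so the ends of an edge are sorted here.  The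
  equivalence allows inductions that build a monomial edge by edge.
\<close>

lemma flat_edges_add_mset:
  "flat_edges k (add_mset e E) \<longleftrightarrow>
    (\<exists>i j. 1 \<le> i \<and> i < j \<and> j \<le> k \<and> e = {Lab i, Lab j}) \<and> flat_edges k E"
proof -
  have "e \<subseteq> Lab ` {1..k} \<and> card e = 2 \<longleftrightarrow> (\<exists>i j. 1 \<le> i \<and> i < j \<and> j \<le> k \<and> e = {Lab i, Lab j})"
  proof
    assume e: "e \<subseteq> Lab ` {1..k} \<and> card e = 2"
    then obtain x y where xy: "e = {x, y}" "x \<noteq> y" by (auto simp: card_2_iff)
    with e have "x \<in> Lab ` {1..k}" "y \<in> Lab ` {1..k}" by auto
    then obtain i j where "x = Lab i" "y = Lab j" "i \<in> {1..k}" "j \<in> {1..k}" by blast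
    with xy have ij: "e = {Lab i, Lab j}" "i \<noteq> j" "i \<in> {1..k}" "j \<in> {1..k}" by auto
    show "\<exists>i j. 1 \<le> i \<and> i < j \<and> j \<le> k \<and> e = {Lab i, Lab j}"
    proof (cases "i < j")
      case True
      then show ?thesis using ij by auto
    next
      case False
      then show ?thesis using ij by (intro exI[of _ j] exI[of _ i]) auto
    qed
  qed auto
  then show ?thesis by (auto simp: flat_edges_def wf_graph_def)
qed

lemma flat_graph_in_graphs: "flat_edges k E \<Longrightarrow> flat_graph k E \<in> graphs k"
  by (auto simp: flat_edges_def flat_graph_def graphs_def labels_abs_lgraph)

lemma all_labeled_flat_graph: "flat_edges k E \<Longrightarrow> all_labeled (flat_graph k E)"
  by (auto simp: flat_edges_def flat_graph_def all_labeled.abs_eq graph_iso_refl)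

lemma all_labeled_graph_cases:
  assumes "G \<in> graphs k" "all_labeled G"
  obtains E where "flat_edges k E" "G = flat_graph k E"
proof -
  obtain g where g: "wf_graph g" "G = abs_lgraph g" by (rule lgraph_exhaust)
  have "{i. Lab i \<in> fst g} = {1..k}" "fst g \<subseteq> range Lab"
    using assms g by (auto simp: graphs_def labels_abs_lgraph all_labeled.abs_eq graph_iso_refl)
  then have "fst g = Lab ` {1..k}" by blast
  then have "g = (Lab ` {1..k}, snd g)" by (metis prod.collapse)
  then show ?thesis using that[of "snd g"] g by (simp add: flat_edges_def flat_graph_def)
qed

lemma flat_graph_plus:
  assumes "flat_edges k E" "flat_edges k F"
  shows "flat_graph k E + flat_graph k F = flat_graph k (E + F)"
  using assms unfolding flat_edges_def flat_graph_def
  by (subst plus_abs_lgraph_labeled) (auto simp: union_graph_def)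

lemma edgeless_Suc_plus_flat_graph:
  assumes "flat_edges k E"
  shows "edgeless (Suc k) + flat_graph k E = flat_graph (Suc k) E"
proof -
  have "Lab ` {1..Suc k} \<union> Lab ` {1..k} = Lab ` {1..Suc k}" by auto
  moreover have "wf_graph (Lab ` {1..Suc k}, {#})" by (simp add: wf_graph_def)
  ultimately show ?thesis
    using assms unfolding flat_edges_def flat_graph_def edgeless_def
    by (subst plus_abs_lgraph_labeled) (auto simp: union_graph_def)
qed

lemma unlabel_flat_graph_Suc:
  assumes "flat_edges k E"
  shows "unlabel (flat_graph (Suc k) E) = unlabel (flat_graph k E) + K1"
proof -
  have wf: "wf_graph (Lab ` {1..k}, E)" using assms by (simp add: flat_edges_def)
  moreover have "Lab ` {1..k} \<subseteq> Lab ` {1..Suc k}" by auto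
  ultimately have wf': "wf_graph (Lab ` {1..Suc k}, E)"
    unfolding wf_graph_def by (metis finite_imageI finite_atLeastAtMost fst_conv snd_conv subset_trans)
  let ?V = "unlabel_vertex ` Lab ` {1..k}" and ?E = "image_mset ((`) unlabel_vertex) E"
  have "{1..Suc k} = insert (Suc k) {1..k}" by auto
  then have "unlabel (flat_graph (Suc k) E) = abs_lgraph (insert (Unl (2 * Suc k)) ?V, ?E)"
    unfolding flat_graph_def unlabel_abs_lgraph[OF wf'] by (simp add: map_graph_def)
  also have "\<dots> = abs_lgraph (?V, ?E) + K1"
    using wf_map[OF wf inj_unlabel_vertex]
    by (intro abs_lgraph_insert_isolated) (auto simp: map_graph_def)
  also have "abs_lgraph (?V, ?E) = unlabel (flat_graph k E)"
    unfolding flat_graph_def unlabel_abs_lgraph[OF wf] by (simp add: map_graph_def)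
  finally show ?thesis .
qed

text \<open>Any numbering of the vertices is a labeling that is undone by forgetting labels.\<close>

lemma unlabel_eq_unlabel_flat_graph:
  obtains k E where "flat_edges k E" "unlabel G = unlabel (flat_graph k E)"
proof -
  obtain g where g: "wf_graph g" "G = abs_lgraph g" by (rule lgraph_exhaust)
  obtain h where "bij_betw h (fst g) {1..card (fst g)}"
    using g(1) finite_same_card_bij[of "fst g" "{1..card (fst g)}"] by (auto simp: wf_graph_def)
  then have h: "inj_on (Lab \<circ> h) (fst g)" "(Lab \<circ> h) ` fst g = Lab ` {1..card (fst g)}"
    by (auto simp: bij_betw_def inj_on_def image_comp[symmetric])
  define E where "E = image_mset ((`) (Lab \<circ> h)) (snd g)"
  have eq: "map_graph (Lab \<circ> h) g = (Lab ` {1..card (fst g)}, E)"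
    using h(2) by (simp add: map_graph_def E_def)
  have "card ((Lab \<circ> h) ` e) = 2" if "e \<in># snd g" for e
    using that g(1) h(1) unfolding wf_graph_def by (metis card_image inj_on_subset)
  then have wf: "wf_graph (map_graph (Lab \<circ> h) g)"
    using g(1) by (auto simp: wf_graph_def map_graph_def)
  then have E: "flat_edges (card (fst g)) E" by (simp add: eq flat_edges_def)
  have "unlabel G = abs_lgraph (map_graph unlabel_vertex g)"
    using g by (simp add: unlabel_abs_lgraph)
  also have "\<dots> = abs_lgraph (map_graph (unlabel_vertex \<circ> (Lab \<circ> h)) g)"
    using g(1) h(1) inj_unlabel_vertex
    by (intro abs_lgraph_renaming) (auto intro: comp_inj_on inj_on_subset)
  also have "\<dots> = unlabel (flat_graph (card (fst g)) E)"
    unfolding flat_graph_def eq[symmetric] unlabel_abs_lgraph[OF wf] map_graph_comp ..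
  finally show ?thesis using that E by blast
qed

section \<open>Coincidence up to labels and isolated vertices\<close>

lemma linear_forget_labels: "linear forget_labels"
proof -
  have "forget_labels = (\<lambda>a. \<Sum>G\<in>Poly_Mapping.keys a.
      Poly_Mapping.lookup a G *\<^sub>R single_graph (unlabel G) 1)"
    by (simp add: forget_labels_def scaleR_single fun_eq_iff)
  then show ?thesis by (rule ssubst) (rule linear_extension)
qed

lemma linear_extend: "linear (extend t)"
proof -
  have "extend t = (\<lambda>a. \<Sum>G\<in>Poly_Mapping.keys a. Poly_Mapping.lookup a G *\<^sub>R t (unlabel G))"
    by (simp add: extend_def fun_eq_iff)
  then show ?thesis by (rule ssubst) (rule linear_extension)
qed

lemma forget_labels_single: "forget_labels (single_graph G 1) = single_graph (unlabel G) 1"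
  by (simp add: forget_labels_def)

lemma extend_single: "extend t (single_graph G 1) = t (unlabel G)"
  by (simp add: extend_def)

text \<open>
  The sums in \<^const>\<open>isolate_span\<close> run over distinct graphs, so the two index sets of a sum have to be
  merged, with coefficients extended by zero.
\<close>

lemma subspace_isolate_span: "subspace isolate_span"
proof -
  let ?B = "\<lambda>G. single_graph (G + K1) 1 - single_graph G 1"
  have sum_eq: "(\<Sum>G\<in>F. single_graph (G + K1) (c G) - single_graph G (c G)) = (\<Sum>G\<in>F. c G *\<^sub>R ?B G)"
    for F c
    by (simp add: scaleR_diff_right scaleR_single)
  have span: "x \<in> isolate_span \<longleftrightarrow>
      (\<exists>F c. finite F \<and> F \<subseteq> graphs 0 \<and> x = (\<Sum>G\<in>F. c G *\<^sub>R ?B G))" for x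
    unfolding isolate_span_def sum_eq by blast
  show ?thesis
    unfolding subspace_def
  proof (intro conjI ballI allI)
    show "0 \<in> isolate_span"
      unfolding span by (intro exI[of _ "{}"]) simp
  next
    fix x y assume "x \<in> isolate_span" "y \<in> isolate_span"
    then obtain F c F' c' where F: "finite F" "F \<subseteq> graphs 0" "x = (\<Sum>G\<in>F. c G *\<^sub>R ?B G)"
      and F': "finite F'" "F' \<subseteq> graphs 0" "y = (\<Sum>G\<in>F'. c' G *\<^sub>R ?B G)"
      unfolding span by blast
    let ?d = "\<lambda>G. (if G \<in> F then c G else 0) + (if G \<in> F' then c' G else 0)"
    have "x = (\<Sum>G\<in>F \<union> F'. (if G \<in> F then c G else 0) *\<^sub>R ?B G)"
      unfolding F(3) using F(1) F'(1) by (intro sum.mono_neutral_cong_left) auto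
    moreover have "y = (\<Sum>G\<in>F \<union> F'. (if G \<in> F' then c' G else 0) *\<^sub>R ?B G)"
      unfolding F'(3) using F(1) F'(1) by (intro sum.mono_neutral_cong_left) auto
    ultimately have "x + y = (\<Sum>G\<in>F \<union> F'. ?d G *\<^sub>R ?B G)"
      by (simp only: scaleR_add_left sum.distrib)
    then show "x + y \<in> isolate_span"
      unfolding span using F(1,2) F'(1,2) by (intro exI[of _ "F \<union> F'"] exI[of _ ?d]) auto
  next
    fix r x assume "x \<in> isolate_span"
    then obtain F c where F: "finite F" "F \<subseteq> graphs 0" "x = (\<Sum>G\<in>F. c G *\<^sub>R ?B G)"
      unfolding span by blast
    then have "r *\<^sub>R x = (\<Sum>G\<in>F. (r * c G) *\<^sub>R ?B G)" by (simp add: scaleR_sum_right)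
    then show "r *\<^sub>R x \<in> isolate_span"
      unfolding span using F(1,2) by (intro exI[of _ F] exI[of _ "\<lambda>G. r * c G"]) simp
  qed
qed

lemma isolate_difference_in_span:
  assumes "G \<in> graphs 0"
  shows "single_graph (G + K1) 1 - single_graph G 1 \<in> isolate_span"
  unfolding isolate_span_def
  using assms by (intro CollectI exI[of _ "{G}"] exI[of _ "\<lambda>_. 1"]) simp

lemma K1_in_graphs_0: "K1 \<in> graphs 0"
  by (auto simp: K1_def graphs_def labels_abs_lgraph wf_graph_def)

lemma add_K1_in_graphs_0: "G \<in> graphs 0 \<Longrightarrow> G + K1 \<in> graphs 0"
  using K1_in_graphs_0 by (simp add: graphs_def labels_plus)

lemma coincide_refl: "coincide x x"
  using subspace_0[OF subspace_isolate_span] by (simp add: coincide_def)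

lemma coincide_trans: "coincide x y \<Longrightarrow> coincide y z \<Longrightarrow> coincide x z"
  using subspace_add[OF subspace_isolate_span, of "forget_labels x - forget_labels y"
      "forget_labels y - forget_labels z"]
  by (simp add: coincide_def)

lemma coincide_sym: "coincide x y \<Longrightarrow> coincide y x"
  using subspace_neg[OF subspace_isolate_span, of "forget_labels x - forget_labels y"]
  by (simp add: coincide_def)

lemma coincide_add: "coincide x y \<Longrightarrow> coincide x' y' \<Longrightarrow> coincide (x + x') (y + y')"
  using subspace_add[OF subspace_isolate_span, of "forget_labels x - forget_labels y"
      "forget_labels x' - forget_labels y'"]
  by (simp add: coincide_def linear_add[OF linear_forget_labels] algebra_simps)

lemma coincide_scaleR: "coincide x y \<Longrightarrow> coincide (c *\<^sub>R x) (c *\<^sub>R y)"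
  using subspace_scale[OF subspace_isolate_span, of "forget_labels x - forget_labels y" c]
  by (simp add: coincide_def linear_scale[OF linear_forget_labels] scaleR_diff_right)

lemma coincide_unlabel: "coincide (single_graph G 1) (single_graph (unlabel G) 1)"
  using subspace_0[OF subspace_isolate_span]
  by (simp add: coincide_def forget_labels_single unlabel_graphs_0[OF unlabel_in_graphs_0])

lemma extend_eq_if_coincide:
  assumes t: "isolate_indifferent t" and xy: "coincide x y"
  shows "extend t x = extend t y"
proof -
  have "extend t v = 0" if "v \<in> isolate_span" for v
  proof -
    from that obtain F c where F: "F \<subseteq> graphs 0"
      and v: "v = (\<Sum>G\<in>F. single_graph (G + K1) (c G) - single_graph G (c G))"
      by (auto simp: isolate_span_def)
    have "extend t (single_graph (G + K1) (c G) - single_graph G (c G)) = 0" if "G \<in> F" for G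
    proof -
      have "G \<in> graphs 0" using that F by blast
      moreover have "single_graph (G + K1) (c G) - single_graph G (c G)
          = c G *\<^sub>R (single_graph (G + K1) 1 - single_graph G 1)"
        by (simp add: scaleR_diff_right scaleR_single)
      ultimately show ?thesis
        using t by (simp add: linear_scale[OF linear_extend] linear_diff[OF linear_extend]
            extend_single unlabel_graphs_0 add_K1_in_graphs_0 isolate_indifferent_def)
    qed
    then show ?thesis by (simp add: v linear_sum[OF linear_extend])
  qed
  moreover have "extend t (forget_labels a) = extend t a" for a
  proof (rule linear_eq_on_singles)
    show "linear (\<lambda>a. extend t (forget_labels a))"
      using linear_compose[OF linear_forget_labels linear_extend] by (simp add: comp_def)
  qed (simp_all add: linear_extend forget_labels_single extend_single
      unlabel_graphs_0[OF unlabel_in_graphs_0])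
  ultimately have "extend t x - extend t y = 0"
    using xy linear_diff[OF linear_extend, of t "forget_labels x" "forget_labels y"]
    by (simp add: coincide_def)
  then show ?thesis by simp
qed

section \<open>The preorders of bounded edge variables\<close>

lemma flat_quantum_add:
  assumes "x \<in> flat_quantum k" "y \<in> flat_quantum k"
  shows "x + y \<in> flat_quantum k"
  using assms Poly_Mapping.keys_add[of x y] by (fastforce simp: flat_quantum_def quantum_def)

lemma flat_quantum_scaleR: "x \<in> flat_quantum k \<Longrightarrow> c *\<^sub>R x \<in> flat_quantum k"
proof -
  have "Poly_Mapping.keys (c *\<^sub>R x) \<subseteq> Poly_Mapping.keys x" by (auto simp: in_keys_iff)
  then show "x \<in> flat_quantum k \<Longrightarrow> c *\<^sub>R x \<in> flat_quantum k"
    by (auto simp: flat_quantum_def quantum_def)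
qed

lemma flat_graph_in_flat_quantum:
  "flat_edges k E \<Longrightarrow> single_graph (flat_graph k E) c \<in> flat_quantum k"
  by (auto simp: flat_quantum_def quantum_def flat_graph_in_graphs all_labeled_flat_graph)

lemma flat_quantum_keys:
  assumes "x \<in> flat_quantum k" "G \<in> Poly_Mapping.keys x"
  obtains E where "flat_edges k E" "G = flat_graph k E"
  using assms by (auto simp: flat_quantum_def quantum_def intro: all_labeled_graph_cases)

text \<open>
  The index set and the family of generators in the definition of \<^const>\<open>bound_preorder\<close>, named in
  order to apply the general results on preorders.
\<close>

definition signed_pairs :: "nat \<Rightarrow> ((nat \<times> nat) \<times> bool) set" where
  "signed_pairs k = {(i, j). 1 \<le> i \<and> i < j \<and> j \<le> k} \<times> {True, False}"

definition bound_generator :: "nat \<Rightarrow> real \<Rightarrow> (nat \<times> nat) \<times> bool \<Rightarrow> quantum_graph" where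
  "bound_generator k d = (\<lambda>((i, j), plus).
    if plus then scalar k d + zvar k i j else scalar k d - zvar k i j)"

lemma bound_preorder_eq:
  "bound_preorder k d = preorder_generated (flat_quantum k) (signed_pairs k) (bound_generator k d)"
  by (simp add: bound_preorder_def signed_pairs_def bound_generator_def)

lemma finite_signed_pairs: "finite (signed_pairs k)"
proof -
  have "{(i, j). 1 \<le> i \<and> i < j \<and> j \<le> k} \<subseteq> {1..k} \<times> {1..k}" by auto
  then have "finite {(i, j). 1 \<le> i \<and> i < j \<and> j \<le> k}" using finite_subset by blast
  then show ?thesis by (simp add: signed_pairs_def)
qed

lemma scalar_eq_scaleR: "scalar k c = c *\<^sub>R scalar k 1"
  by (simp add: scalar_def scaleR_single)

lemma scalar_0_one: "scalar 0 1 = 1"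
proof -
  have "edgeless 0 = 0" by (simp add: edgeless_def zero_lgraph_def)
  then show ?thesis by (simp add: scalar_def)
qed

lemma scalar_in_flat_quantum: "scalar k c \<in> flat_quantum k"
  by (simp add: scalar_def edgeless_eq_flat_graph flat_graph_in_flat_quantum)

lemma scalar_one_times_flat: "x \<in> flat_quantum k \<Longrightarrow> scalar k 1 * x = x"
  by (rule scalar_one_times) (simp add: flat_quantum_def)

lemma zvar_in_flat_quantum:
  assumes "1 \<le> i" "i < j" "j \<le> k"
  shows "zvar k i j \<in> flat_quantum k"
proof -
  have "flat_edges k {#{Lab i, Lab j}#}" using assms by (auto simp: flat_edges_add_mset)
  then show ?thesis by (simp add: zvar_def edge_graph_eq_flat_graph flat_graph_in_flat_quantum)
qed

lemma bound_generator_eq: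
  "bound_generator k d ((i, j), b) =
    d *\<^sub>R scalar k 1 + (if b then zvar k i j else - zvar k i j)"
  by (simp add: bound_generator_def scalar_eq_scaleR[of k d])

lemma bound_generator_in_flat_quantum:
  assumes "p \<in> signed_pairs k"
  shows "bound_generator k d p \<in> flat_quantum k"
proof -
  obtain i j b where p: "p = ((i, j), b)" "1 \<le> i" "i < j" "j \<le> k"
    using assms by (auto simp: signed_pairs_def)
  have "(if b then zvar k i j else - zvar k i j) = (if b then 1 else - 1 :: real) *\<^sub>R zvar k i j"
    by simp
  then show ?thesis
    unfolding p(1) bound_generator_eq using p(2-4)
    by (simp only: flat_quantum_add flat_quantum_scaleR scalar_in_flat_quantum zvar_in_flat_quantum)
qed

lemma bound_preorder_add:
  "x \<in> bound_preorder k d \<Longrightarrow> y \<in> bound_preorder k d \<Longrightarrow> x + y \<in> bound_preorder k d"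
  unfolding bound_preorder_eq by (rule preorder_generated_add)

lemma bound_preorder_mult:
  "x \<in> bound_preorder k d \<Longrightarrow> y \<in> bound_preorder k d \<Longrightarrow> x * y \<in> bound_preorder k d"
  unfolding bound_preorder_eq
  by (rule preorder_generated_mult)
    (auto simp: flat_quantum_times bound_generator_in_flat_quantum finite_signed_pairs)

lemma square_in_bound_preorder: "b \<in> flat_quantum k \<Longrightarrow> b\<^sup>2 \<in> bound_preorder k d"
  unfolding bound_preorder_eq
  using preorder_generated_term[OF finite_signed_pairs, of "{}" k b "flat_quantum k"
      "bound_generator k d"]
  by simp

lemma scalar_one_square: "(scalar k 1)\<^sup>2 = scalar k 1"
  using scalar_one_times_flat[OF scalar_in_flat_quantum] by (simp add: power2_eq_square)

lemma scalar_one_in_bound_preorder: "scalar k 1 \<in> bound_preorder k d"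
  using square_in_bound_preorder[OF scalar_in_flat_quantum[of k 1]] by (simp add: scalar_one_square)

lemma bound_generator_in_bound_preorder:
  "p \<in> signed_pairs k \<Longrightarrow> bound_generator k d p \<in> bound_preorder k d"
  using preorder_generated_term[OF finite_signed_pairs, of "{p}" k "scalar k 1" "flat_quantum k"
      "bound_generator k d"]
  unfolding bound_preorder_eq
  by (simp add: scalar_in_flat_quantum scalar_one_square scalar_one_times_flat
      bound_generator_in_flat_quantum)

lemma bound_preorder_in_flat_quantum:
  assumes "x \<in> bound_preorder k d"
  shows "x \<in> flat_quantum k"
  using assms finite_signed_pairs unfolding bound_preorder_eq
proof (induction rule: preorder_generated_induct)
  case zero
  show ?case by (simp add: flat_quantum_def quantum_def)
next
  case (gen b e)
  then show ?case
    using finite_subset[OF _ finite_signed_pairs]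
    by (auto intro!: mult_prod_in
        simp: flat_quantum_times bound_generator_in_flat_quantum power2_eq_square subset_iff)
qed (rule flat_quantum_add)

lemma bound_preorder_scaleR:
  assumes "0 \<le> c" "x \<in> bound_preorder k d"
  shows "c *\<^sub>R x \<in> bound_preorder k d"
proof -
  have "(sqrt c *\<^sub>R scalar k 1)\<^sup>2 * x = c *\<^sub>R (scalar k 1 * x)"
    using assms(1) scalar_one_square by (simp add: power2_eq_square)
  also have "\<dots> = c *\<^sub>R x" using assms(2)
    by (simp add: scalar_one_times_flat bound_preorder_in_flat_quantum)
  moreover have "(sqrt c *\<^sub>R scalar k 1)\<^sup>2 \<in> bound_preorder k d"
    by (intro square_in_bound_preorder flat_quantum_scaleR scalar_in_flat_quantum)
  ultimately show ?thesis using bound_preorder_mult[OF _ assms(2)] by metis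
qed

text \<open>
  Multiplying a monomial \<open>m\<close> by a variable \<open>z\<close> uses the identities
  \<open>2 (d D + z m) = (d + z) (D + m) + (d - z) (D - m)\<close> and
  \<open>2 (d D - z m) = (d + z) (D - m) + (d - z) (D + m)\<close>, whose right-hand sides are in the preorder if
  \<open>D + m\<close> and \<open>D - m\<close> are.
\<close>

lemma monomial_bound_in_preorder:
  assumes d: "0 < d"
  shows "flat_edges k E \<Longrightarrow>
    d ^ size E *\<^sub>R scalar k 1 + single_graph (flat_graph k E) 1 \<in> bound_preorder k d
    \<and> d ^ size E *\<^sub>R scalar k 1 - single_graph (flat_graph k E) 1 \<in> bound_preorder k d"
proof (induction E)
  case empty
  have "scalar k 1 + scalar k 1 \<in> bound_preorder k d"
    by (intro bound_preorder_add scalar_one_in_bound_preorder)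
  moreover have "0 \<in> bound_preorder k d"
    unfolding bound_preorder_eq by (rule preorder_generated_zero)
  ultimately show ?case by (simp add: scalar_def edgeless_eq_flat_graph)
next
  case (add e E)
  let ?u = "scalar k 1" and ?m = "single_graph (flat_graph k E) 1" and ?D = "d ^ size E"
  obtain i j where ij: "1 \<le> i" "i < j" "j \<le> k" "e = {Lab i, Lab j}" and E: "flat_edges k E"
    using add.prems by (auto simp: flat_edges_add_mset)
  let ?z = "zvar k i j"
  have IH: "?D *\<^sub>R ?u + ?m \<in> bound_preorder k d" "?D *\<^sub>R ?u - ?m \<in> bound_preorder k d"
    using add.IH E by auto
  have "((i, j), b) \<in> signed_pairs k" for b using ij by (auto simp: signed_pairs_def)
  from bound_generator_in_bound_preorder[OF this[of True], of d]
    bound_generator_in_bound_preorder[OF this[of False], of d]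
  have z: "d *\<^sub>R ?u + ?z \<in> bound_preorder k d" "d *\<^sub>R ?u - ?z \<in> bound_preorder k d"
    by (simp_all add: bound_generator_eq)
  have e: "flat_edges k {#e#}" using ij by (auto simp: flat_edges_add_mset)
  have zm: "?z * ?m = single_graph (flat_graph k (add_mset e E)) 1"
    using flat_graph_plus[OF e E] by (simp add: zvar_def edge_graph_eq_flat_graph mult_single ij(4))
  have u: "?u * ?u = ?u" "?u * ?m = ?m" "?u * ?z = ?z"
    using ij E by (simp_all add: scalar_one_times_flat scalar_in_flat_quantum
        flat_graph_in_flat_quantum zvar_in_flat_quantum)
  have u': "?m * ?u = ?m" "?z * ?u = ?z"
    using u by (simp_all add: mult.commute)
  have "(d *\<^sub>R ?u + ?z) * (?D *\<^sub>R ?u + ?m) + (d *\<^sub>R ?u - ?z) * (?D *\<^sub>R ?u - ?m)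
      = ((d * ?D) *\<^sub>R ?u + ?z * ?m) + ((d * ?D) *\<^sub>R ?u + ?z * ?m)"
    by (simp add: algebra_simps u u')
  moreover have "(d *\<^sub>R ?u + ?z) * (?D *\<^sub>R ?u - ?m) + (d *\<^sub>R ?u - ?z) * (?D *\<^sub>R ?u + ?m)
      = ((d * ?D) *\<^sub>R ?u - ?z * ?m) + ((d * ?D) *\<^sub>R ?u - ?z * ?m)"
    by (simp add: algebra_simps u u')
  ultimately have "((d * ?D) *\<^sub>R ?u + ?z * ?m) + ((d * ?D) *\<^sub>R ?u + ?z * ?m) \<in> bound_preorder k d"
    "((d * ?D) *\<^sub>R ?u - ?z * ?m) + ((d * ?D) *\<^sub>R ?u - ?z * ?m) \<in> bound_preorder k d"
    using bound_preorder_add bound_preorder_mult IH z by metis+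
  from this[THEN bound_preorder_scaleR[of "1 / 2", rotated]] show ?case
    by (simp only: scaleR_half_double zm size_add_mset power_Suc)
qed

text \<open>
  Multiplication by the identity of the algebra of \<open>(k + 1)\<close>-labeled graphs adds an isolated vertex
  labeled \<open>k + 1\<close> to each graph on the labels \<open>1, \<dots>, k\<close>.  Hence it embeds the algebra for \<open>k\<close> into the
  one for \<open>k + 1\<close> without any effect on coincidence.
\<close>

lemma coincide_embed:
  assumes "x \<in> flat_quantum k"
  shows "coincide (scalar (Suc k) 1 * x) x"
proof -
  let ?f = "\<lambda>x. forget_labels (scalar (Suc k) 1 * x) - forget_labels x"
  have "linear ?f"
    by (rule linearI) (simp_all add: linear_add[OF linear_forget_labels]
        linear_scale[OF linear_forget_labels] algebra_simps)
  then have "?f x \<in> isolate_span"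
    using subspace_isolate_span
  proof (rule linear_in_subspace)
    fix G assume "G \<in> Poly_Mapping.keys x"
    with assms obtain E where E: "flat_edges k E" "G = flat_graph k E"
      by (rule flat_quantum_keys)
    then have "?f (single_graph G 1)
        = single_graph (unlabel G + K1) 1 - single_graph (unlabel G) 1"
      by (simp add: scalar_def mult_single edgeless_Suc_plus_flat_graph forget_labels_single
          unlabel_flat_graph_Suc)
    then show "?f (single_graph G 1) \<in> isolate_span"
      by (simp add: isolate_difference_in_span unlabel_in_graphs_0)
  qed
  then show ?thesis by (simp add: coincide_def)
qed

lemma embed_flat_quantum:
  assumes "x \<in> flat_quantum k"
  shows "scalar (Suc k) 1 * x \<in> flat_quantum (Suc k)"
proof -
  have "labels (edgeless (Suc k) + G) = {1..Suc k}" "all_labeled (edgeless (Suc k) + G)"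
    if "G \<in> Poly_Mapping.keys x" for G
    using assms that flat_graph_in_graphs[of "Suc k" "{#}"] all_labeled_flat_graph[of "Suc k" "{#}"]
    by (auto simp: flat_quantum_def quantum_def graphs_def labels_plus all_labeled_plus
        edgeless_eq_flat_graph)
  then show ?thesis
    using keys_mult[of "scalar (Suc k) 1" x]
    by (fastforce simp: flat_quantum_def quantum_def graphs_def scalar_def)
qed

lemma embed_scalar: "scalar (Suc k) 1 * scalar k 1 = scalar (Suc k) 1"
  by (simp add: scalar_def mult_single edgeless_eq_flat_graph[of k] edgeless_Suc_plus_flat_graph)
    (simp add: edgeless_eq_flat_graph)

lemma embed_bound_generator:
  assumes "p \<in> signed_pairs k"
  shows "scalar (Suc k) 1 * bound_generator k d p = bound_generator (Suc k) d p"
proof -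
  obtain i j b where p: "p = ((i, j), b)" "1 \<le> i" "i < j" "j \<le> k"
    using assms by (auto simp: signed_pairs_def)
  have "flat_edges k {#{Lab i, Lab j}#}" using p by (auto simp: flat_edges_add_mset)
  then have "scalar (Suc k) 1 * zvar k i j = zvar (Suc k) i j"
    by (simp add: scalar_def zvar_def edge_graph_eq_flat_graph mult_single
        edgeless_Suc_plus_flat_graph)
  then show ?thesis by (simp add: p(1) bound_generator_eq distrib_left embed_scalar)
qed

text \<open>
  The embedding is multiplication by an idempotent \<open>v\<close>, which can be distributed to all factors of
  \<open>b\<^sup>2 \<Prod> r\<close>; this turns \<open>b\<close> and the generators \<open>r\<close> into elements and generators for \<open>k + 1\<close>.  One
  factor \<open>v\<close> always stays with the square, which takes care of empty products.
\<close>

lemma embed_bound_preorder: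
  assumes "x \<in> bound_preorder k d"
  shows "scalar (Suc k) 1 * x \<in> bound_preorder (Suc k) d"
  using assms finite_signed_pairs unfolding bound_preorder_eq[of k]
proof (induction rule: preorder_generated_induct)
  case zero
  show ?case unfolding bound_preorder_eq by (simp add: preorder_generated_zero)
next
  case (add x y)
  then show ?case by (simp add: distrib_left bound_preorder_add)
next
  case (gen b e)
  let ?v = "scalar (Suc k) 1"
  have e: "finite e" "e \<subseteq> signed_pairs k" using gen finite_subset[OF _ finite_signed_pairs] by auto
  have v: "?v * (?v * y) = ?v * y" for y
    using scalar_one_times_flat[OF scalar_in_flat_quantum[of "Suc k" 1]] by (simp flip: mult.assoc)
  have prod: "?v * prod (bound_generator k d) e = ?v * prod (bound_generator (Suc k) d) e"
    using e
  proof (induction e rule: finite_induct)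
    case (insert p e)
    have "(?v * bound_generator k d p) * (?v * prod (bound_generator k d) e)
        = ?v * (?v * (bound_generator k d p * prod (bound_generator k d) e))"
      by (simp only: ac_simps)
    then have "?v * prod (bound_generator k d) (insert p e)
        = (?v * bound_generator k d p) * (?v * prod (bound_generator k d) e)"
      using insert.hyps by (simp add: v)
    also have "\<dots> = bound_generator (Suc k) d p * (?v * prod (bound_generator (Suc k) d) e)"
      using insert by (simp add: embed_bound_generator)
    finally show ?case using insert by (simp add: ac_simps)
  qed simp
  have "?v * (b\<^sup>2 * prod (bound_generator k d) e) = b\<^sup>2 * (?v * prod (bound_generator k d) e)"
    by (simp add: ac_simps)
  also have "\<dots> = (?v * b)\<^sup>2 * prod (bound_generator (Suc k) d) e"
    using v by (simp add: prod power2_eq_square ac_simps)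
  also have "\<dots> \<in> bound_preorder (Suc k) d"
    unfolding bound_preorder_eq
  proof (rule preorder_generated_term[OF finite_signed_pairs])
    show "e \<subseteq> signed_pairs (Suc k)" using e(2) by (auto simp: signed_pairs_def)
    show "?v * b \<in> flat_quantum (Suc k)" using gen by (simp add: embed_flat_quantum)
  qed
  finally show ?case .
qed

lemma coincide_scalar: "coincide (scalar k c) (scalar 0 c)"
proof -
  have "coincide (scalar k 1) (scalar 0 1)"
  proof (induction k)
    case (Suc k)
    then show ?case
      using coincide_trans coincide_embed[OF scalar_in_flat_quantum[of k 1]] by (metis embed_scalar)
  qed (rule coincide_refl)
  from coincide_scaleR[OF this, of c] show ?thesis
    by (simp add: scalar_eq_scaleR[of k c] scalar_eq_scaleR[of 0 c])
qed

section \<open>Graph parameters on the preorders\<close>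

text \<open>
  This is how the bound on \<^const>\<open>K2\<close> becomes a bound on the moments of an edge variable: the power
  \<open>z\<^sub>i\<^sub>j\<^sup>m\<close> is \<^const>\<open>K2\<close> together with \<open>k - 2\<close> isolated vertices.
\<close>

lemma parallel_edges_value:
  assumes t: "isolate_indifferent t" and ij: "1 \<le> i" "i < j" "j \<le> k"
  shows "t (unlabel (flat_graph k (replicate_mset m {Lab i, Lab j}))) = t (K2 m)"
proof -
  let ?E = "replicate_mset m {Lab i, Lab j}"
  let ?x = "Unl (2 * i)" and ?y = "Unl (2 * j)"
  let ?W = "unlabel_vertex ` Lab ` {1..k}"
  have wf: "wf_graph (Lab ` {1..k}, ?E)" using ij by (auto simp: wf_graph_def)
  have "unlabel (flat_graph k ?E) = abs_lgraph (?W, replicate_mset m {?x, ?y})"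
    unfolding flat_graph_def unlabel_abs_lgraph[OF wf] by (simp add: map_graph_def)
  also have "?W = {?x, ?y} \<union> ?W"
    using ij by (auto simp: image_image)
  also have "t (abs_lgraph ({?x, ?y} \<union> ?W, replicate_mset m {?x, ?y}))
      = t (abs_lgraph ({?x, ?y}, replicate_mset m {?x, ?y}))"
    using t ij by (intro isolate_indifferent_add_vertices) (auto simp: wf_graph_def)
  also have "abs_lgraph ({?x, ?y}, replicate_mset m {?x, ?y}) = K2 m"
    using ij by (intro K2_eq_abs_lgraph[symmetric]) auto
  finally show ?thesis .
qed

lemma unit_times_zvar_power:
  assumes "1 \<le> i" "i < j" "j \<le> k"
  shows "scalar k 1 * zvar k i j ^ m =
    single_graph (flat_graph k (replicate_mset m {Lab i, Lab j})) 1"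
proof (induction m)
  case 0
  then show ?case by (simp add: scalar_def edgeless_eq_flat_graph)
next
  case (Suc m)
  let ?e = "{Lab i, Lab j}"
  have e: "flat_edges k {#?e#}" using assms by (auto simp: flat_edges_add_mset)
  have "flat_edges k (replicate_mset m ?e)" using assms by (auto simp: flat_edges_def wf_graph_def)
  note plus = flat_graph_plus[OF e this]
  have "scalar k 1 * zvar k i j ^ Suc m = zvar k i j * (scalar k 1 * zvar k i j ^ m)"
    by (simp add: ac_simps)
  also have "\<dots> = single_graph (flat_graph k (replicate_mset (Suc m) ?e)) 1"
    unfolding Suc using plus by (simp add: zvar_def edge_graph_eq_flat_graph mult_single)
  finally show ?case .
qed

lemma bounded_parameter_nonneg_on_bound_preorder:
  assumes t: "isolate_indifferent t" "flatly_reflection_positive t" "bounded_parameter d t"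
    and d: "0 < d" and x: "x \<in> bound_preorder k d"
  shows "0 \<le> extend t x"
proof -
  let ?z = "\<lambda>((i, j), b). if b then zvar k i j else - zvar k i j"
  have z: "?z p \<in> flat_quantum k" "bound_generator k d p = d *\<^sub>R scalar k 1 + ?z p"
    "\<bar>extend t (scalar k 1 * ?z p ^ m)\<bar> \<le> d ^ m" if "p \<in> signed_pairs k" for p m
  proof -
    from that obtain i j b where p: "p = ((i, j), b)" and ij: "1 \<le> i" "i < j" "j \<le> k"
      by (auto simp: signed_pairs_def)
    show "?z p \<in> flat_quantum k"
      using zvar_in_flat_quantum[OF ij] flat_quantum_scaleR[OF zvar_in_flat_quantum[OF ij], of "- 1"]
      by (simp add: p)
    show "bound_generator k d p = d *\<^sub>R scalar k 1 + ?z p"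
      by (simp add: p bound_generator_eq)
    have "\<bar>extend t (scalar k 1 * zvar k i j ^ m)\<bar> \<le> d ^ m"
      using t(3) by (simp add: unit_times_zvar_power[OF ij] extend_single
          parallel_edges_value[OF t(1) ij] bounded_parameter_def)
    moreover have "scalar k 1 * (- zvar k i j) ^ m
        = (- 1 :: real) ^ m *\<^sub>R (scalar k 1 * zvar k i j ^ m)"
      by (subst power_minus) (simp add: minus_one_power_iff)
    ultimately show "\<bar>extend t (scalar k 1 * ?z p ^ m)\<bar> \<le> d ^ m"
      by (simp add: p linear_scale[OF linear_extend] abs_mult power_abs)
  qed
  have pos: "0 \<le> extend t (b\<^sup>2)" if "b \<in> flat_quantum k" for b
    using t(2) that by (auto simp: flatly_reflection_positive_def)
  show ?thesis
    using x unfolding bound_preorder_eq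
    by (rule positive_on_preorder[OF linear_extend flat_quantum_add flat_quantum_times
          flat_quantum_scaleR scalar_in_flat_quantum scalar_one_times_flat pos
          finite_signed_pairs d z, rotated -1])
qed

text \<open>
  The bound for \<open>m = 0\<close> concerns two isolated vertices, which an isolate indifferent parameter
  does not distinguish from the empty graph.
\<close>

lemma bounded_parameter_extend_one_le:
  assumes t: "isolate_indifferent t" "bounded_parameter d t"
  shows "extend t 1 \<le> 1"
proof -
  have "t (K2 0) = t (abs_lgraph ({} \<union> {Unl 0, Unl 1}, {#}))" by (simp add: K2_def)
  also have "\<dots> = t (abs_lgraph ({}, {#}))"
    by (rule isolate_indifferent_add_vertices[OF t(1)]) (auto simp: wf_graph_def)
  also have "\<dots> = extend t 1"
  proof -
    have "(0::lgraph) \<in> graphs 0"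
      using unlabel_in_graphs_0[of 0]
      by (auto simp: zero_lgraph_def graphs_def labels_abs_lgraph wf_graph_def)
    then have "extend t 1 = t 0" using extend_single[of t 0] by (simp add: unlabel_graphs_0)
    then show ?thesis by (simp add: zero_lgraph_def)
  qed
  finally have "\<bar>extend t 1\<bar> \<le> d ^ 0"
    using t(2) unfolding bounded_parameter_def by metis
  then show ?thesis by simp
qed

section \<open>The cone of elements that coincide with preorder elements\<close>

definition bound_cone :: "real \<Rightarrow> quantum_graph set" where
  "bound_cone d = {x. \<exists>k. \<exists>\<sigma>\<in>bound_preorder k d. coincide x \<sigma>}"

lemma bound_preorder_subset_cone: "x \<in> bound_preorder k d \<Longrightarrow> x \<in> bound_cone d"
  using coincide_refl by (auto simp: bound_cone_def)

lemma bound_cone_cong: "coincide x y \<Longrightarrow> y \<in> bound_cone d \<Longrightarrow> x \<in> bound_cone d"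
  unfolding bound_cone_def using coincide_trans by blast

lemma bound_preorder_raise:
  assumes "\<sigma> \<in> bound_preorder k d" "k \<le> l"
  shows "\<exists>\<tau>\<in>bound_preorder l d. coincide \<sigma> \<tau>"
  using assms(2)
proof (induction l rule: dec_induct)
  case base
  then show ?case using assms(1) coincide_refl by blast
next
  case (step l)
  then obtain \<tau> where \<tau>: "\<tau> \<in> bound_preorder l d" "coincide \<sigma> \<tau>" by blast
  then have "coincide \<sigma> (scalar (Suc l) 1 * \<tau>)"
    using coincide_trans coincide_sym coincide_embed bound_preorder_in_flat_quantum by blast
  then show ?case using embed_bound_preorder \<tau>(1) by blast
qed

text \<open>
  Summands from preorders with different numbers of labels are first raised to the larger number.
\<close>

lemma vector_cone_bound_cone: "vector_cone (bound_cone d)"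
  unfolding vector_cone_def
proof (intro conjI ballI allI impI)
  have "0 \<in> bound_preorder 0 d" unfolding bound_preorder_eq by (rule preorder_generated_zero)
  then show "0 \<in> bound_cone d" by (rule bound_preorder_subset_cone)
next
  fix x y assume "x \<in> bound_cone d" "y \<in> bound_cone d"
  then obtain k \<sigma> l \<tau> where
    "\<sigma> \<in> bound_preorder k d" "coincide x \<sigma>" "\<tau> \<in> bound_preorder l d" "coincide y \<tau>"
    by (auto simp: bound_cone_def)
  moreover from this obtain \<sigma>' \<tau>' where
    "\<sigma>' \<in> bound_preorder (max k l) d" "coincide \<sigma> \<sigma>'"
    "\<tau>' \<in> bound_preorder (max k l) d" "coincide \<tau> \<tau>'"
    using bound_preorder_raise[of \<sigma> k d "max k l"] bound_preorder_raise[of \<tau> l d "max k l"] by auto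
  ultimately have "\<sigma>' + \<tau>' \<in> bound_preorder (max k l) d" "coincide (x + y) (\<sigma>' + \<tau>')"
    by (auto intro: bound_preorder_add coincide_add coincide_trans)
  then show "x + y \<in> bound_cone d" by (auto simp: bound_cone_def)
next
  fix c :: real and x assume "0 \<le> c" "x \<in> bound_cone d"
  then show "c *\<^sub>R x \<in> bound_cone d"
    unfolding bound_cone_def using bound_preorder_scaleR coincide_scaleR by blast
qed

lemma one_in_bound_cone: "1 \<in> bound_cone d"
  using bound_preorder_subset_cone[OF scalar_one_in_bound_preorder[of 0 d]] by (simp add: scalar_0_one)

text \<open>
  A labeled graph may be replaced by a monomial with the same underlying unlabeled graph, and the
  bounds for monomials add up.
\<close>

lemma one_order_unit:
  assumes d: "0 < d"
  shows "\<exists>N. N *\<^sub>R 1 - x \<in> bound_cone d"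
proof -
  note cone = vector_coneD[OF vector_cone_bound_cone[of d]]
  have monomial: "\<exists>N. N *\<^sub>R 1 - c *\<^sub>R single_graph G 1 \<in> bound_cone d" for c G
  proof -
    obtain k E where E: "flat_edges k E" "unlabel G = unlabel (flat_graph k E)"
      by (rule unlabel_eq_unlabel_flat_graph)
    let ?m = "single_graph (flat_graph k E) 1" and ?D = "d ^ size E"
    have "(\<bar>c\<bar> * ?D) *\<^sub>R scalar k 1 - c *\<^sub>R ?m \<in> bound_preorder k d"
    proof (cases "0 \<le> c")
      case True
      then show ?thesis
        using bound_preorder_scaleR[OF True] monomial_bound_in_preorder[OF d E(1)]
        by (fastforce simp: scaleR_diff_right)
    next
      case False
      have "(- c) *\<^sub>R (?D *\<^sub>R scalar k 1 + ?m) \<in> bound_preorder k d"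
        using False monomial_bound_in_preorder[OF d E(1)] by (intro bound_preorder_scaleR) auto
      then show ?thesis using False by (simp add: scaleR_add_right)
    qed
    then have mem: "(\<bar>c\<bar> * ?D) *\<^sub>R scalar k 1 - c *\<^sub>R ?m \<in> bound_cone d"
      by (rule bound_preorder_subset_cone)
    have "coincide (single_graph G 1) ?m"
      using coincide_unlabel[of G] coincide_sym[OF coincide_unlabel[of "flat_graph k E"]] E(2)
      by (auto intro: coincide_trans)
    moreover have "coincide 1 (scalar k 1)"
      using coincide_sym[OF coincide_scalar[of k 1]] by (simp add: scalar_0_one)
    ultimately have "coincide ((\<bar>c\<bar> * ?D) *\<^sub>R 1 + (- c) *\<^sub>R single_graph G 1)
        ((\<bar>c\<bar> * ?D) *\<^sub>R scalar k 1 + (- c) *\<^sub>R ?m)"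
      by (intro coincide_add coincide_scaleR)
    then have "(\<bar>c\<bar> * ?D) *\<^sub>R 1 - c *\<^sub>R single_graph G 1 \<in> bound_cone d"
      using bound_cone_cong[OF _ mem] by simp
    then show ?thesis by blast
  qed
  have "\<exists>N. N *\<^sub>R 1 - (\<Sum>G\<in>A. Poly_Mapping.lookup x G *\<^sub>R single_graph G 1) \<in> bound_cone d"
    if "finite A" for A
    using that
  proof (induction A rule: finite_induct)
    case empty
    have "0 *\<^sub>R 1 - 0 \<in> bound_cone d" using cone(1) by simp
    then show ?case unfolding sum.empty by blast
  next
    case (insert G A)
    then obtain N where
      N: "N *\<^sub>R 1 - (\<Sum>G\<in>A. Poly_Mapping.lookup x G *\<^sub>R single_graph G 1) \<in> bound_cone d"
      by blast
    obtain N' where N': "N' *\<^sub>R 1 - Poly_Mapping.lookup x G *\<^sub>R single_graph G 1 \<in> bound_cone d"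
      using monomial by blast
    have "(N' + N) *\<^sub>R 1 - (\<Sum>G\<in>insert G A. Poly_Mapping.lookup x G *\<^sub>R single_graph G 1)
        \<in> bound_cone d"
      using cone(2)[OF N' N] insert.hyps by (simp add: algebra_simps)
    then show ?case by blast
  qed
  from this[of "Poly_Mapping.keys x"] show ?thesis by (simp flip: poly_mapping_expansion)
qed

section \<open>The equivalence\<close>

text \<open>
  The difference of two coinciding elements and its negative both lie in the cone, because they
  coincide with 0.  So the functional depends only on the class of an element up to labels and
  isolated vertices, and it is recovered from its values on graphs.
\<close>

lemma cone_functional_parameter:
  fixes L :: "quantum_graph \<Rightarrow> real"
  assumes d: "0 < d" and L: "linear L" "\<And>x. x \<in> bound_cone d \<Longrightarrow> 0 \<le> L x" "L 1 = 1"
  defines "t \<equiv> (\<lambda>G. L (single_graph G 1))"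
  shows "isolate_indifferent t" "flatly_reflection_positive t" "bounded_parameter d t"
    "extend t a = L a"
proof -
  have L_coincide: "L x = L y" if "coincide x y" for x y
  proof -
    have zero: "0 \<in> bound_cone d" by (rule vector_coneD(1)[OF vector_cone_bound_cone])
    have "coincide (x - y) 0" "coincide (y - x) 0"
      using coincide_add[OF that coincide_refl[of "- y"]]
        coincide_add[OF coincide_sym[OF that] coincide_refl[of "- x"]] by simp_all
    then have "0 \<le> L (x - y)" "0 \<le> L (y - x)"
      using bound_cone_cong zero L(2) by blast+
    then show ?thesis by (simp add: linear_diff[OF L(1)])
  qed
  have extend: "extend t b = L b" for b
    using linear_extend L(1)
    by (rule linear_eq_on_singles)
      (simp add: extend_single t_def L_coincide[OF coincide_unlabel, symmetric])
  then show "extend t a = L a" .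
  show "isolate_indifferent t"
    unfolding isolate_indifferent_def
  proof
    fix G assume G: "G \<in> graphs 0"
    have "coincide (single_graph (G + K1) 1) (single_graph G 1)"
      using G isolate_difference_in_span[OF G]
      by (simp add: coincide_def forget_labels_single unlabel_graphs_0 add_K1_in_graphs_0)
    then show "t (G + K1) = t G" unfolding t_def by (rule L_coincide)
  qed
  show "flatly_reflection_positive t"
    unfolding flatly_reflection_positive_def extend
    using L(2) bound_preorder_subset_cone square_in_bound_preorder by blast
  show "bounded_parameter d t"
    unfolding bounded_parameter_def
  proof
    fix m
    let ?E = "replicate_mset m {Lab 1, Lab 2}"
    have E: "flat_edges 2 ?E" by (auto simp: flat_edges_def wf_graph_def)
    have "L (scalar 2 1) = 1"
      using L_coincide[OF coincide_scalar[of 2 1]] L(3) by (simp add: scalar_0_one)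
    moreover have "0 \<le> L (d ^ m *\<^sub>R scalar 2 1 + single_graph (flat_graph 2 ?E) 1)"
      "0 \<le> L (d ^ m *\<^sub>R scalar 2 1 - single_graph (flat_graph 2 ?E) 1)"
      using monomial_bound_in_preorder[OF d E] L(2) bound_preorder_subset_cone by auto
    ultimately have "\<bar>L (single_graph (flat_graph 2 ?E) 1)\<bar> \<le> d ^ m"
      by (simp add: linear_add[OF L(1)] linear_diff[OF L(1)] linear_scale[OF L(1)] abs_le_iff)
    also have "L (single_graph (flat_graph 2 ?E) 1) = t (unlabel (flat_graph 2 ?E))"
      unfolding t_def by (rule L_coincide[OF coincide_unlabel])
    also have "\<dots> = t (K2 m)"
      by (rule parallel_edges_value[OF \<open>isolate_indifferent t\<close>]) auto
    finally show "\<bar>t (K2 m)\<bar> \<le> d ^ m" .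
  qed
qed

theorem theorem3p2:
  fixes d :: real and a :: quantum_graph
  assumes "d > 0" and "a \<in> quantum 0"
  shows "(\<forall>t. isolate_indifferent t \<and> flatly_reflection_positive t \<and> bounded_parameter d t
            \<longrightarrow> extend t a \<ge> 0)
     \<longleftrightarrow> (\<forall>\<epsilon>>0. \<exists>k. \<exists>\<sigma> \<in> bound_preorder k d. coincide (a + scalar 0 \<epsilon>) \<sigma>)"
proof (intro iffI allI impI; (elim conjE)?)
  fix \<epsilon> :: real
  assume nonneg: "\<forall>t. isolate_indifferent t \<and> flatly_reflection_positive t \<and> bounded_parameter d t
      \<longrightarrow> extend t a \<ge> 0" and \<epsilon>: "0 < \<epsilon>"
  have "a + scalar 0 \<epsilon> \<in> bound_cone d"
  proof (rule ccontr)
    assume "a + scalar 0 \<epsilon> \<notin> bound_cone d"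
    then obtain L :: "quantum_graph \<Rightarrow> real" where L: "linear L"
      "\<And>x. x \<in> bound_cone d \<Longrightarrow> 0 \<le> L x" "L 1 = 1" "L (a + scalar 0 \<epsilon>) \<le> 0"
      using vector_cone_separation[OF vector_cone_bound_cone one_in_bound_cone
          one_order_unit[OF \<open>d > 0\<close>]] by metis
    have "0 \<le> L a"
      using nonneg cone_functional_parameter[OF \<open>d > 0\<close> L(1-3)] by metis
    moreover have "scalar 0 \<epsilon> = \<epsilon> *\<^sub>R 1"
      using scalar_eq_scaleR[of 0 \<epsilon>] by (simp add: scalar_0_one)
    then have "L (a + scalar 0 \<epsilon>) = L a + \<epsilon>"
      by (simp add: linear_add[OF L(1)] linear_scale[OF L(1)] L(3))
    ultimately show False using L(4) \<epsilon> by simp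
  qed
  then show "\<exists>k. \<exists>\<sigma>\<in>bound_preorder k d. coincide (a + scalar 0 \<epsilon>) \<sigma>"
    by (simp add: bound_cone_def)
next
  fix t
  assume approx: "\<forall>\<epsilon>>0. \<exists>k. \<exists>\<sigma>\<in>bound_preorder k d. coincide (a + scalar 0 \<epsilon>) \<sigma>"
    and t: "isolate_indifferent t" "flatly_reflection_positive t" "bounded_parameter d t"
  show "0 \<le> extend t a"
  proof (rule field_le_epsilon)
    fix \<epsilon> :: real assume \<epsilon>: "0 < \<epsilon>"
    then obtain k \<sigma> where "\<sigma> \<in> bound_preorder k d" "coincide (a + scalar 0 \<epsilon>) \<sigma>"
      using approx by blast
    then have "0 \<le> extend t (a + scalar 0 \<epsilon>)"
      using bounded_parameter_nonneg_on_bound_preorder[OF t \<open>d > 0\<close>] extend_eq_if_coincide[OF t(1)]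
      by simp
    also have "scalar 0 \<epsilon> = \<epsilon> *\<^sub>R 1"
      using scalar_eq_scaleR[of 0 \<epsilon>] by (simp add: scalar_0_one)
    then have "extend t (a + scalar 0 \<epsilon>) = extend t a + \<epsilon> * extend t 1"
      by (simp add: linear_add[OF linear_extend] linear_scale[OF linear_extend])
    also have "\<dots> \<le> extend t a + \<epsilon>"
      using bounded_parameter_extend_one_le[OF t(1,3)] \<epsilon> by simp
    finally show "0 \<le> extend t a + \<epsilon>" .
  qed
qed

end
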